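(* Let $A,B$ be integers with $-B/2<A\leqslant B/2$ and suppose $\phi_{A,B}(\rho)=0$. Define $$c_0:=\begin{cases}\exp(2\pi iA/B)&\text{if }A\neq0,\\ \exp(\pi i/(12B))&\text{if }A=0,\end{cases}\qquad c_{n+1}:=c_n-\frac{\phi_{A,B}(c_n)}{\phi_{A,B}'(c_n)}\ (n\geqslant0).$$ Then the sequence $(c_n)$ converges quadratically to $\rho$, and $$\rho=e^{2\pi iA/B}\left(1+\frac{-\operatorname{Cl}_2(2\pi A/B)+i\pi^2B_2(|A|/B)}{2\pi B}\right)+O\!\left(\frac{1+\log B}{B^2}\right)$$ with an absolute implied constant.
   Context: $\log$ is the principal logarithm ($-\pi<\arg z\leqslant\pi$, cut $(-\infty,0]$). $\operatorname{Li}_2$ is the principal dilogarithm: $\sum_{n\geqslant1}z^n/n^2$ for $|z|\leqslant1$, continued to $\mathbb{C}\setminus[1,\infty)$ by $-\int_0^z\log(1-u)\,du/u$, and on $[1,\infty)$ defined as the limit from below. For $A,B\in\mathbb{Z}$, $\phi_{A,B}(z):=\operatorname{Li}_2(z)+4\pi^2A+2\pi iB\log z$, and $\phi_{A,B}'(z):=\bigl(-\log(1-z)+2\pi iB\bigr)/z$ (its derivative off $(-\infty,0]\cup[1,\infty)$). $B_2(x)=x^2-x+1/6$ is the second Bernoulli polynomial and $\operatorname{Cl}_2(\theta)=-\int_0^\theta\log|2\sin(x/2)|\,dx$ is Clausen's integral. *)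

theory Defs
  imports "HOL-Complex_Analysis.Complex_Analysis"
begin

(* The integrand has a removable singularity at 0; its junk value there does not affect the
   integral. *)
definition dilog_integral :: "complex \<Rightarrow> complex" where
  "dilog_integral z = - contour_integral (linepath 0 z) (\<lambda>u. Ln (1 - u) / u)"

(* On the cut the value is the limit from the lower half-plane, which matches the convention
   arg = pi for Ln (1 - z) when z > 1. *)
definition dilog :: "complex \<Rightarrow> complex" where
  "dilog z =
     (if norm z \<le> 1 then (\<Sum>n. z ^ Suc n / of_nat (Suc n) ^ 2)
      else if z \<in> complex_of_real ` {1..} then Lim (at z within {w. Im w < 0}) dilog_integral
      else dilog_integral z)"

(* Meaningful only for z \<noteq> 0. *)
definition phi :: "int \<Rightarrow> int \<Rightarrow> complex \<Rightarrow> complex" where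
  "phi A B z = dilog z + 4 * of_real pi ^ 2 * of_int A + 2 * of_real pi * \<i> * of_int B * Ln z"

(* Meaningful only for z \<noteq> 0 and z \<noteq> 1. *)
definition dphi :: "int \<Rightarrow> int \<Rightarrow> complex \<Rightarrow> complex" where
  "dphi A B z = (- Ln (1 - z) + 2 * of_real pi * \<i> * of_int B) / z"

definition bernoulli_poly2 :: "real \<Rightarrow> real" where
  "bernoulli_poly2 x = x ^ 2 - x + 1 / 6"

(* The interval integral is oriented, so that negative arguments are covered. *)
definition clausen :: "real \<Rightarrow> real" where
  "clausen \<theta> = - (LBINT x=0..\<theta>. ln \<bar>2 * sin (x / 2)\<bar>)"

primrec newton_seq :: "int \<Rightarrow> int \<Rightarrow> nat \<Rightarrow> complex" where
  "newton_seq A B 0 =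
     (if A \<noteq> 0 then exp (2 * of_real pi * \<i> * of_int A / of_int B)
      else exp (of_real pi * \<i> / (12 * of_int B)))"
| "newton_seq A B (Suc n) =
     newton_seq A B n - phi A B (newton_seq A B n) / dphi A B (newton_seq A B n)"

definition converges_quadratically :: "(nat \<Rightarrow> complex) \<Rightarrow> complex \<Rightarrow> bool" where
  "converges_quadratically c l \<longleftrightarrow>
     c \<longlonglongrightarrow> l \<and> (\<exists>K. \<forall>n. norm (c (Suc n) - l) \<le> K * norm (c n - l) ^ 2)"

definition zero_approx :: "int \<Rightarrow> int \<Rightarrow> complex" where
  "zero_approx A B =
     exp (2 * of_real pi * \<i> * of_int A / of_int B) *
     (1 + (- of_real (clausen (2 * pi * of_int A / of_int B))
           + \<i> * of_real pi ^ 2 * of_real (bernoulli_poly2 (of_int \<bar>A\<bar> / of_int B)))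
          / (2 * of_real pi * of_int B))"

end

theory Submission
  imports Defs
begin

text \<open>
  Write \<open>w = log \<rho>\<close>. Then \<open>\<rho>\<close> is a zero of \<open>phi A B\<close> if and only if
  \<open>w = 2 \<pi> i A / B + i Li\<^sub>2(\<rho>) / (2 \<pi> B)\<close>. Since \<open>Im Li\<^sub>2(z)\<close> has the sign of \<open>Im z\<close>,
  the real part of this equation puts \<open>\<rho>\<close> either inside the unit disc and in the upper half-plane,
  or outside the disc and in the lower half-plane; its imaginary part shows that these cases are
  \<open>A \<ge> 0\<close> and \<open>A < 0\<close>. In both \<open>|Li\<^sub>2(\<rho>)| \<le> 3\<close>, so \<open>\<rho>\<close> lies within an explicit \<open>O(1/B)\<close> of
  \<open>c = exp (2 \<pi> i A / B)\<close>. Newton's method for a function \<open>f\<close> such that \<open>f'\<close> is \<open>M\<close>-Lipschitz and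
  \<open>|f'| \<ge> m\<close> on a convex set multiplies the error \<open>e\<close> by at most \<open>M e / (2 m)\<close>, and the constants
  are good enough for this to contract for every \<open>B \<ge> 1\<close>. If \<open>A = 0\<close>, the zero is close to the
  singularity 1. There \<open>w = i \<pi> / (12 B) (1 - i D / (2 \<pi> B))\<^sup>-\<^sup>1\<close>, where \<open>D\<close> is the difference quotient of
  \<open>Li\<^sub>2(exp z)\<close> between 0 and \<open>w\<close>. It has nonnegative real and imaginary parts, which makes the
  distance to the initial value about half of the distance to 1.

  Replacing \<open>Li\<^sub>2(\<rho>)\<close> by \<open>Li\<^sub>2(c)\<close> in the equation changes \<open>w\<close> by \<open>O((1 + log B) / B\<^sup>2)\<close>, because
  the derivative of \<open>Li\<^sub>2\<close> is \<open>O(1 + log B)\<close> at distance of order \<open>1/B\<close> from 1. On the unit circle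
  \<open>Li\<^sub>2\<close> is given by \<open>B\<^sub>2\<close> and \<open>Cl\<^sub>2\<close>.
\<close>

subsection \<open>The dilogarithm on the slit plane\<close>

lemma basel_sums: "(\<lambda>n. 1 / real (Suc n) ^ 2) sums (pi ^ 2 / 6)"
  using inverse_squares_sums by (simp add: add.commute)

lemma norm_dilog_term_le:
  assumes "norm (z::complex) \<le> 1"
  shows "norm (z ^ Suc n / of_nat (Suc n) ^ 2) \<le> 1 / real (Suc n) ^ 2"
proof -
  have "norm z ^ Suc n \<le> 1"
    using assms by (intro power_le_one) auto
  thus ?thesis
    unfolding norm_divide norm_power norm_of_nat by (intro divide_right_mono) auto
qed

lemma summable_dilog_term:
  assumes "norm (z::complex) \<le> 1"
  shows "summable (\<lambda>n. z ^ Suc n / of_nat (Suc n) ^ 2)"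
  by (rule summable_comparison_test'[OF sums_summable[OF basel_sums]])
     (rule norm_dilog_term_le[OF assms])

lemma norm_dilog_le:
  assumes "norm z \<le> 1"
  shows "norm (dilog z) \<le> pi ^ 2 / 6"
  using norm_suminf_le[OF norm_dilog_term_le[OF assms] sums_summable[OF basel_sums]]
  unfolding dilog_def sums_unique[OF basel_sums] by (simp only: assms if_True)

lemma dilog_one: "dilog 1 = of_real (pi ^ 2 / 6)"
proof -
  have "(\<lambda>n. of_real (1 / real (Suc n) ^ 2) :: complex) sums of_real (pi ^ 2 / 6)"
    by (rule sums_of_real[OF basel_sums])
  hence "(\<lambda>n. 1 ^ Suc n / of_nat (Suc n) ^ 2 :: complex) sums of_real (pi ^ 2 / 6)"
    by simp
  thus ?thesis
    unfolding dilog_def by (simp add: sums_iff)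
qed

lemma dilog_cnj:
  assumes "norm z \<le> 1"
  shows "dilog (cnj z) = cnj (dilog z)"
proof -
  have "(\<lambda>n. cnj (z ^ Suc n / of_nat (Suc n) ^ 2)) sums cnj (\<Sum>n. z ^ Suc n / of_nat (Suc n) ^ 2)"
    unfolding sums_cnj by (rule summable_sums[OF summable_dilog_term[OF assms]])
  from sums_unique[OF this] show ?thesis
    by (simp add: dilog_def assms)
qed

text \<open>The majorant \<open>1 / n^2\<close> is valid up to the boundary, so the convergence is
  uniform on the closed disc. This carries identities to the unit circle, including the point 1, by
  taking limits.\<close>

lemma continuous_on_dilog_cball: "continuous_on (cball 0 1) dilog"
proof -
  have "continuous_on (cball 0 1) (\<lambda>z::complex. \<Sum>n. z ^ Suc n / of_nat (Suc n) ^ 2)"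
  proof (rule uniform_limit_theorem)
    show "uniform_limit (cball 0 1) (\<lambda>n z. \<Sum>i<n. z ^ Suc i / of_nat (Suc i) ^ 2)
      (\<lambda>z::complex. \<Sum>n. z ^ Suc n / of_nat (Suc n) ^ 2) sequentially"
      by (rule Weierstrass_m_test[OF norm_dilog_term_le sums_summable[OF basel_sums]]) auto
    show "\<forall>\<^sub>F n in sequentially. continuous_on (cball 0 1)
      (\<lambda>z::complex. \<Sum>i<n. z ^ Suc i / of_nat (Suc i) ^ 2)"
      by (intro always_eventually allI continuous_intros) (auto simp del: of_nat_Suc)
  qed simp
  thus ?thesis
    by (rule continuous_on_eq) (auto simp: dilog_def)
qed

section \<open>Agreement of series and integral on the plane slit along [1, infinity)\<close>

lemma one_minus_in_nonpos_Reals_iff: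
  "1 - z \<in> \<real>\<^sub>\<le>\<^sub>0 \<longleftrightarrow> z \<in> complex_of_real ` {1..}"
  by (auto simp: complex_nonpos_Reals_iff complex_eq_iff image_iff Bex_def)

text \<open>The value at 0 fills the removable singularity, so that a primitive exists across
  0.\<close>

definition dilog_deriv :: "complex \<Rightarrow> complex" where
  "dilog_deriv z = (if z = 0 then 1 else - Ln (1 - z) / z)"

lemma dilog_series_has_field_derivative:
  assumes "norm z < 1"
  shows "((\<lambda>z. \<Sum>n. z ^ Suc n / of_nat (Suc n) ^ 2) has_field_derivative dilog_deriv z) (at z)"
proof -
  \<comment> \<open>Division by zero gives \<open>c 0 = 0\<close>, so the power series may start at
    index 0. Then \<open>diffs c n\<close> is \<open>1 / (n + 1)\<close>, the coefficient in the
    expansion of \<open>- Ln (1 - z) / z\<close>.\<close>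
  define c :: "nat \<Rightarrow> complex" where "c = (\<lambda>n. 1 / of_nat n ^ 2)"
  have sm: "summable (\<lambda>n. c n * x ^ n)" if "norm x \<le> 1" for x :: complex
    using summable_dilog_term[OF that] by (subst summable_Suc_iff[symmetric]) (simp add: c_def)
  have eq: "(\<Sum>n. x ^ Suc n / of_nat (Suc n) ^ 2) = (\<Sum>n. c n * x ^ n)" if "norm x \<le> 1" for x :: complex
    using suminf_split_head[OF sm[OF that]] by (simp add: c_def)
  have "((\<lambda>z. \<Sum>n. c n * z ^ n) has_field_derivative (\<Sum>n. diffs c n * z ^ n)) (at z)"
    using assms by (intro termdiffs_strong[OF sm[of 1]]) auto
  moreover have "(\<Sum>n. diffs c n * z ^ n) = dilog_deriv z"
  proof (cases "z = 0")
    case True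
    have "(\<Sum>n. diffs c n * 0 ^ n) = diffs c 0"
      using powser_zero[of "diffs c"] by simp
    thus ?thesis
      using True by (simp add: dilog_deriv_def c_def diffs_def)
  next
    case False
    have "(\<lambda>n. - (z ^ n) / of_nat n) sums Ln (1 + (- z))"
      using Ln_series'[of "- z"] assms by simp
    hence "(\<lambda>n. - (z ^ Suc n) / of_nat (Suc n)) sums Ln (1 - z)"
      by (subst sums_Suc_iff) simp
    from sums_divide[OF sums_minus[OF this], of z]
    have "(\<lambda>n. diffs c n * z ^ n) sums (- Ln (1 - z) / z)"
      using False by (simp add: diffs_def c_def power2_eq_square field_simps del: of_nat_Suc)
    thus ?thesis
      using False by (simp add: dilog_deriv_def sums_iff)
  qed
  ultimately have "((\<lambda>z. \<Sum>n. c n * z ^ n) has_field_derivative dilog_deriv z) (at z)"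
    by simp
  moreover have "\<forall>\<^sub>F x in nhds z. (\<Sum>n. x ^ Suc n / of_nat (Suc n) ^ 2) = (\<Sum>n. c n * x ^ n)"
    using eventually_nhds_in_open[of "ball 0 1" z] assms
    by (auto elim!: eventually_mono intro!: eq simp del: power_Suc of_nat_Suc)
  ultimately show ?thesis
    by (subst DERIV_cong_ev[OF refl _ refl])
qed

lemma open_slit_plane: "open (- complex_of_real ` {1..})"
proof -
  have "closed (complex_of_real ` {1..})"
    by (rule closed_injective_linear_image)
       (auto intro: bounded_linear.linear bounded_linear_of_real simp: inj_on_def)
  thus ?thesis by (rule open_Compl)
qed

lemma closed_segment_slit_plane:
  assumes "z \<notin> complex_of_real ` {1..}"
  shows "closed_segment 0 z \<subseteq> - complex_of_real ` {1..}"
proof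
  fix x assume "x \<in> closed_segment 0 z"
  then obtain u where u: "0 \<le> u" "u \<le> 1" "x = of_real u * z"
    by (auto simp: in_segment scaleR_conv_of_real)
  show "x \<in> - complex_of_real ` {1..}"
  proof (rule ComplI)
    assume "x \<in> complex_of_real ` {1..}"
    then obtain r where r: "r \<ge> 1" "x = of_real r" by auto
    have "u \<noteq> 0" using r u by auto
    have "z = of_real (r / u)"
      using r u \<open>u \<noteq> 0\<close> by (simp add: field_simps)
    moreover have "r / u \<ge> 1"
      using r u \<open>u \<noteq> 0\<close> by (simp add: field_simps)
    ultimately show False using assms by (metis atLeast_iff imageI)
  qed
qed

lemma dilog_deriv_tendsto_0: "(dilog_deriv \<longlongrightarrow> dilog_deriv 0) (at 0)"
proof -
  have "((\<lambda>z. - Ln (1 - z)) has_field_derivative 1) (at 0)"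
    by (auto intro!: derivative_eq_intros simp: complex_nonpos_Reals_iff)
  hence "(\<lambda>z. - Ln (1 - z) / z) \<midarrow>0\<rightarrow> 1"
    by (simp add: DERIV_def)
  moreover have "\<forall>\<^sub>F z in at 0. - Ln (1 - z) / z = dilog_deriv z"
    by (auto simp: dilog_deriv_def eventually_at intro!: exI[of _ 1])
  ultimately have "dilog_deriv \<midarrow>0\<rightarrow> 1"
    by (rule Lim_transform_eventually)
  thus ?thesis
    by (simp add: dilog_deriv_def)
qed

text \<open>The slit plane is starlike about 0. Differentiability away from 0 and continuity at 0
  are what Cauchy's theorem with an exceptional point asks for.\<close>

lemma dilog_primitive:
  obtains G where "G 0 = 0"
    "\<And>z. z \<notin> complex_of_real ` {1..} \<Longrightarrow> (G has_field_derivative dilog_deriv z) (at z)"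
proof -
  define S where "S = - complex_of_real ` {1..}"
  have fd: "dilog_deriv field_differentiable at z" if "z \<in> S - {0}" for z
  proof -
    have "((\<lambda>z. - Ln (1 - z) / z) has_field_derivative
        ((1 / (1 - z)) * z - (- Ln (1 - z)) * 1) / (z * z)) (at z)"
      using that by (auto intro!: derivative_eq_intros
          simp: S_def one_minus_in_nonpos_Reals_iff field_simps)
    moreover have "\<forall>\<^sub>F x in nhds z. - Ln (1 - x) / x = dilog_deriv x"
      using eventually_nhds_in_open[of "- {0}" z] that
      by (auto elim!: eventually_mono simp: dilog_deriv_def)
    ultimately have "(dilog_deriv has_field_derivative
        ((1 / (1 - z)) * z - (- Ln (1 - z)) * 1) / (z * z)) (at z)"
      by (simp only: DERIV_cong_ev[OF refl _ refl])
    thus ?thesis unfolding field_differentiable_def by blast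
  qed
  have "continuous_on S dilog_deriv"
  proof (rule continuous_at_imp_continuous_on, rule ballI)
    fix z assume "z \<in> S"
    show "isCont dilog_deriv z"
    proof (cases "z = 0")
      case True
      thus ?thesis using dilog_deriv_tendsto_0 by (simp add: isCont_def)
    next
      case False
      thus ?thesis
        using fd[of z] \<open>z \<in> S\<close> field_differentiable_imp_continuous_at by blast
    qed
  qed
  moreover have "starlike S"
    unfolding starlike_def S_def using closed_segment_slit_plane by (intro bexI[of _ 0]) auto
  moreover have "open S"
    unfolding S_def by (rule open_slit_plane)
  ultimately obtain g where g: "\<And>z. z \<in> S \<Longrightarrow> (g has_field_derivative dilog_deriv z) (at z)"
    using holomorphic_starlike_primitive[of S dilog_deriv "{0}"] fd by blast
  show thesis
  proof (rule that[of "\<lambda>z. g z - g 0"])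
    fix z :: complex assume "z \<notin> complex_of_real ` {1..}"
    thus "((\<lambda>z. g z - g 0) has_field_derivative dilog_deriv z) (at z)"
      using g[of z] by (auto intro!: derivative_eq_intros simp: S_def)
  qed simp
qed

text \<open>One primitive matches all branches of the definition: the fundamental theorem along the
  segment from 0 gives the integral, equal derivatives give the series in the open disc, and on the
  unit circle both sides are limits along the radius.\<close>

lemma dilog_eq_primitive:
  assumes G0: "G 0 = 0"
    and G: "\<And>z. z \<notin> complex_of_real ` {1..} \<Longrightarrow> (G has_field_derivative dilog_deriv z) (at z)"
    and z: "z \<notin> complex_of_real ` {1..}"
  shows "dilog z = G z" "dilog_integral z = G z"
proof -
  have int: "dilog_integral z = G z" if z: "z \<notin> complex_of_real ` {1..}" for z
  proof -
    have "(dilog_deriv has_contour_integral (G (pathfinish (linepath 0 z)) - G (pathstart (linepath 0 z))))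
            (linepath 0 z)"
    proof (rule contour_integral_primitive)
      show "(G has_field_derivative dilog_deriv x) (at x within - complex_of_real ` {1..})"
        if "x \<in> - complex_of_real ` {1..}" for x
        by (rule has_field_derivative_at_within[OF G]) (use that in simp)
      show "path_image (linepath 0 z) \<subseteq> - complex_of_real ` {1..}"
        unfolding path_image_linepath by (rule closed_segment_slit_plane[OF z])
    qed (rule valid_path_linepath)
    hence "((\<lambda>x. dilog_deriv (linepath 0 z x) * z) has_integral G z) {0..1}"
      unfolding has_contour_integral_linepath pathfinish_linepath pathstart_linepath G0 diff_zero .
    \<comment> \<open>At the starting point the quotient takes the default value of division by zero
      instead of the limit 1; changing finitely many values does not affect the integral.\<close>
    hence "((\<lambda>x. - (Ln (1 - linepath 0 z x) / linepath 0 z x) * z) has_integral G z) {0..1}"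
    proof (rule has_integral_spike_finite[of "{0, 1}", rotated 2])
      fix x :: real assume "x \<in> {0..1} - {0, 1}"
      thus "- (Ln (1 - linepath 0 z x) / linepath 0 z x) * z = dilog_deriv (linepath 0 z x) * z"
        by (auto simp: dilog_deriv_def)
    qed simp
    hence "((\<lambda>u. - (Ln (1 - u) / u)) has_contour_integral G z) (linepath 0 z)"
      unfolding has_contour_integral_linepath diff_zero .
    from has_contour_integral_neg[OF this]
    have "((\<lambda>u. Ln (1 - u) / u) has_contour_integral - G z) (linepath 0 z)"
      unfolding minus_minus .
    from contour_integral_unique[OF this] show ?thesis
      unfolding dilog_integral_def by simp
  qed
  show "dilog_integral z = G z" by (rule int[OF z])
  define f :: "complex \<Rightarrow> complex" where "f = (\<lambda>z. \<Sum>n. z ^ Suc n / of_nat (Suc n) ^ 2)"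
  have f_dilog: "f x = dilog x" if "norm x \<le> 1" for x
    using that by (simp add: f_def dilog_def)
  have inside: "f x = G x" if "norm x < 1" for x
  proof -
    have "\<exists>c. \<forall>x\<in>ball 0 1. G x - f x = c"
    proof (rule has_field_derivative_zero_constant)
      fix x :: complex assume x: "x \<in> ball 0 1"
      hence "x \<notin> complex_of_real ` {1..}" by auto
      moreover have "(f has_field_derivative dilog_deriv x) (at x)"
        using dilog_series_has_field_derivative[of x] x unfolding f_def by simp
      ultimately have "((\<lambda>x. G x - f x) has_field_derivative dilog_deriv x - dilog_deriv x) (at x)"
        by (intro DERIV_diff G)
      thus "((\<lambda>x. G x - f x) has_field_derivative 0) (at x within ball 0 1)"
        by (simp add: has_field_derivative_at_within)
    qed simp
    then obtain c where c: "\<And>x. x \<in> ball 0 1 \<Longrightarrow> G x - f x = c" by blast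
    have "c = 0" using c[of 0] by (simp add: G0 f_def)
    thus ?thesis using c[of x] that by simp
  qed
  show "dilog z = G z"
  proof (cases "norm z \<le> 1")
    case False
    thus ?thesis using z int[OF z] by (simp add: dilog_def)
  next
    case True
    have "((\<lambda>t. of_real t * z) \<longlongrightarrow> of_real 1 * z) (at_left (1::real))"
      by (intro tendsto_intros)
    hence t: "((\<lambda>t. of_real t * z) \<longlongrightarrow> z) (at_left (1::real))" by simp
    have ev: "\<forall>\<^sub>F t in at_left (1::real). 0 < t \<and> t < 1"
      by (auto simp: eventually_at_left_field intro!: exI[of _ 0])
    have tz: "norm (of_real t * z) < 1" if "0 < t" "t < 1" for t :: real
    proof -
      have "norm (of_real t * z) = t * norm z" using that by (simp add: norm_mult)
      also have "\<dots> \<le> t" using True that by (simp add: mult_left_le)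
      finally show ?thesis using that by simp
    qed
    have lim: "((\<lambda>t. dilog (of_real t * z)) \<longlongrightarrow> dilog z) (at_left (1::real))"
    proof (rule continuous_on_tendsto_compose[OF continuous_on_dilog_cball t])
      show "z \<in> cball 0 1" using True by simp
      show "\<forall>\<^sub>F t in at_left (1::real). of_real t * z \<in> cball 0 1"
        using ev by eventually_elim (use tz in \<open>auto intro: less_imp_le\<close>)
    qed
    have "((\<lambda>t. G (of_real t * z)) \<longlongrightarrow> G z) (at_left (1::real))"
      using isCont_tendsto_compose[OF DERIV_isCont[OF G[OF z]] t] .
    moreover have "\<forall>\<^sub>F t in at_left (1::real). G (of_real t * z) = dilog (of_real t * z)"
      using ev
    proof eventually_elim
      case (elim t)
      thus ?case
        using tz[of t] inside[of "of_real t * z"] f_dilog[of "of_real t * z"] by simp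
    qed
    ultimately have "((\<lambda>t. dilog (of_real t * z)) \<longlongrightarrow> G z) (at_left (1::real))"
      by (rule Lim_transform_eventually)
    with lim show ?thesis
      by (rule tendsto_unique[rotated]) simp
  qed
qed

lemma has_field_derivative_dilog':
  assumes "z \<notin> complex_of_real ` {1..}"
  shows "(dilog has_field_derivative dilog_deriv z) (at z)"
proof -
  obtain G where G: "G 0 = 0"
    "\<And>z. z \<notin> complex_of_real ` {1..} \<Longrightarrow> (G has_field_derivative dilog_deriv z) (at z)"
    using dilog_primitive by blast
  have "\<forall>\<^sub>F x in nhds z. x \<in> - complex_of_real ` {1..}"
    using assms by (intro eventually_nhds_in_open open_slit_plane) auto
  hence "\<forall>\<^sub>F x in nhds z. dilog x = G x"
    by eventually_elim (use dilog_eq_primitive(1)[OF G] in auto)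
  thus ?thesis
    using G(2)[OF assms] DERIV_cong_ev[OF refl _ refl] by blast
qed

lemma has_field_derivative_dilog:
  assumes "z \<notin> complex_of_real ` {1..}" "z \<noteq> 0"
  shows "(dilog has_field_derivative - Ln (1 - z) / z) (at z)"
  using has_field_derivative_dilog'[OF assms(1)] assms(2) by (simp add: dilog_deriv_def)

lemma dilog_integral_eq_dilog:
  assumes "z \<notin> complex_of_real ` {1..}"
  shows "dilog_integral z = dilog z"
proof -
  obtain G where G: "G 0 = 0"
    "\<And>z. z \<notin> complex_of_real ` {1..} \<Longrightarrow> (G has_field_derivative dilog_deriv z) (at z)"
    using dilog_primitive by blast
  from dilog_eq_primitive[OF G assms] show ?thesis by simp
qed

section \<open>Sign of the imaginary part of the dilogarithm\<close>

lemma not_in_slit: "Im z \<noteq> 0 \<Longrightarrow> z \<notin> complex_of_real ` {1..}" "Re z < 1 \<Longrightarrow> z \<notin> complex_of_real ` {1..}"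
  by auto

lemma dilog_0 [simp]: "dilog 0 = 0"
  by (simp add: dilog_def)

text \<open>Mean value theorem for \<open>Im (dilog (t z))\<close> on [0, 1]: the factor
  \<open>z\<close> from the chain rule cancels the denominator and leaves
  \<open>- Ln (1 - t z) / t\<close>. Hence the sign is opposite to that of the argument of
  \<open>1 - t z\<close> for some \<open>t\<close>.\<close>

lemma Im_dilog_radial:
  assumes z: "z \<notin> complex_of_real ` {1..}"
  obtains t where "0 < t" "t < 1" "Im (dilog z) = - Im (Ln (1 - of_real t * z)) / t"
proof (cases "z = 0")
  case True
  show ?thesis by (rule that[of "1/2"]) (simp_all add: True)
next
  case False
  define f where "f = (\<lambda>t. Im (dilog (of_real t * z)))"
  have nin: "of_real t * z \<notin> complex_of_real ` {1..}" if "0 \<le> t" "t \<le> 1" for t :: real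
  proof -
    have "of_real t * z \<in> closed_segment 0 z"
      using that by (auto simp: in_segment scaleR_conv_of_real)
    thus ?thesis using closed_segment_slit_plane[OF z] by blast
  qed
  have der: "(f has_real_derivative Im (dilog_deriv (of_real t * z) * z)) (at t)"
    if "0 \<le> t" "t \<le> 1" for t
  proof -
    have "((\<lambda>t. dilog (of_real t * z)) has_vector_derivative (z * dilog_deriv (of_real t * z))) (at t)"
      by (rule field_vector_diff_chain_at[of "\<lambda>t. of_real t * z", unfolded o_def])
         (auto intro!: derivative_eq_intros has_field_derivative_dilog'[OF nin] that)
    hence "(f has_vector_derivative Im (z * dilog_deriv (of_real t * z))) (at t)"
      unfolding f_def by (intro derivative_intros bounded_linear.has_vector_derivative[OF bounded_linear_Im])
    thus ?thesis
      by (simp add: has_real_derivative_iff_has_vector_derivative mult.commute)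
  qed
  have "\<exists>t. 0 < t \<and> t < 1 \<and> f 1 - f 0 = (1 - 0) * Im (dilog_deriv (of_real t * z) * z)"
    by (rule MVT2) (use der in simp_all)
  then obtain t where t: "0 < t" "t < 1" "f 1 - f 0 = Im (dilog_deriv (of_real t * z) * z)"
    by auto
  have "dilog_deriv (of_real t * z) * z = - Ln (1 - of_real t * z) / of_real t"
    using t False by (simp add: dilog_deriv_def)
  hence "Im (dilog z) = - Im (Ln (1 - of_real t * z)) / t"
    using t by (simp add: f_def flip: of_real_minus)
  thus ?thesis using t that by blast
qed

lemma Im_dilog_pos:
  assumes "Im z > 0"
  shows "Im (dilog z) > 0"
proof -
  obtain t where t: "0 < t" "t < 1" "Im (dilog z) = - Im (Ln (1 - of_real t * z)) / t"
    using Im_dilog_radial[OF not_in_slit(1)[of z]] assms by (metis less_irrefl)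
  have "Im (1 - of_real t * z) < 0" using t assms by simp
  hence "Im (Ln (1 - of_real t * z)) < 0"
    using Im_Ln_pos_le mpi_less_Im_Ln Im_Ln_le_pi
    by (metis linorder_not_le zero_complex.sel(2) less_irrefl)
  thus ?thesis
    unfolding t(3) using t(1) by (simp add: zero_less_divide_iff divide_less_0_iff)
qed

lemma Im_dilog_neg:
  assumes "Im z < 0"
  shows "Im (dilog z) < 0"
proof -
  obtain t where t: "0 < t" "t < 1" "Im (dilog z) = - Im (Ln (1 - of_real t * z)) / t"
    using Im_dilog_radial[OF not_in_slit(1)[of z]] assms by (metis less_irrefl)
  have "Im (1 - of_real t * z) > 0" using t assms by (simp add: mult_pos_neg)
  hence "Im (Ln (1 - of_real t * z)) > 0" using Im_Ln_pos_lt_imp by blast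
  thus ?thesis
    unfolding t(3) using t(1) by (simp add: zero_less_divide_iff divide_less_0_iff)
qed

lemma Im_dilog_real:
  assumes "x < 1"
  shows "Im (dilog (of_real x)) = 0"
proof -
  obtain t where t: "0 < t" "t < 1"
      "Im (dilog (of_real x)) = - Im (Ln (1 - of_real t * of_real x)) / t"
    using Im_dilog_radial[OF not_in_slit(2), of "of_real x"] assms by auto
  have "t * x < 1"
  proof (cases "x \<le> 0")
    case True thus ?thesis using t mult_nonneg_nonpos[of t x] by simp
  next
    case False thus ?thesis using t assms mult_strict_mono[of t 1 x 1] by simp
  qed
  hence "Ln (1 - of_real t * of_real x) = of_real (ln (1 - t * x))"
    by (subst Ln_of_real[symmetric]) auto
  thus ?thesis using t by simp
qed

subsection \<open>Inversion and values on the unit circle\<close>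

text \<open>The arguments of \<open>1 - z\<close> and \<open>z\<close> lie in (0, pi) and (-pi, 0),
  so the imaginary part of the right-hand side stays in (-pi, pi) and no multiple of 2 pi i has to
  be added.\<close>

lemma Ln_one_minus_inverse:
  assumes "Im z < 0"
  shows "Ln (1 - 1 / z) = Ln (1 - z) - Ln z - \<i> * of_real pi"
proof (rule Ln_unique)
  have z: "z \<noteq> 0" "1 - z \<noteq> 0" using assms by auto
  have "exp (Ln (1 - z) - Ln z - \<i> * of_real pi) = (1 - z) / z / (- 1)"
    unfolding exp_diff exp_pi_i' using z by simp
  thus "exp (Ln (1 - z) - Ln z - \<i> * of_real pi) = 1 - 1 / z"
    using z by (simp add: field_simps)
  have "0 < Im (Ln (1 - z))" "Im (Ln (1 - z)) < pi"
    using Im_Ln_pos_lt_imp[of "1 - z"] assms by auto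
  moreover have "Im (Ln z) < 0" "- pi < Im (Ln z)"
    using z assms mpi_less_Im_Ln[of z] Im_Ln_pos_le[of z] Im_Ln_le_pi[of z] by (auto simp: not_le[symmetric])
  ultimately show "- pi < Im (Ln (1 - z) - Ln z - \<i> * of_real pi)"
    "Im (Ln (1 - z) - Ln z - \<i> * of_real pi) \<le> pi" by auto
qed

lemma tendsto_dilog_cis: "((\<lambda>t. dilog (cis (g t))) \<longlongrightarrow> dilog (cis a)) F" if "(g \<longlongrightarrow> a) F"
  by (rule continuous_on_tendsto_compose[OF continuous_on_dilog_cball])
     (auto intro!: tendsto_cis that)

lemma Ln_cis: "Ln (cis t) = \<i> * of_real t" if "- pi < t" "t \<le> pi"
  using that by (intro Ln_unique) (auto simp: cis_conv_exp)

lemma one_divide_cis: "1 / cis (- t) = cis t"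
  by (simp add: divide_inverse cis_inverse)

text \<open>By the identity for \<open>Ln (1 - 1 / z)\<close> the function \<open>F\<close> has
  derivative 0 on the lower half-plane. Its constant value is found by letting \<open>z\<close> tend
  to 1 along the unit circle from below, where \<open>1 / z\<close> stays on the circle: 2 (pi^2 /
  6) - pi^2 / 2 = - pi^2 / 6.\<close>

lemma dilog_inversion:
  assumes "Im z < 0"
  shows "dilog z = - dilog (1 / z) - of_real (pi ^ 2 / 6) - (Ln z + \<i> * of_real pi) ^ 2 / 2"
proof -
  define S where "S = {z. Im z < 0}"
  define F where "F = (\<lambda>z. dilog z + dilog (1 / z) + (Ln z + \<i> * of_real pi) ^ 2 / 2)"
  have "\<exists>c. \<forall>z\<in>S. F z = c"
  proof (rule has_field_derivative_zero_constant)
    show "convex S" unfolding S_def by (rule convex_halfspace_Im_lt)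
    fix x assume "x \<in> S"
    hence x: "Im x < 0" "x \<noteq> 0" "1 / x \<noteq> 0" "x \<notin> \<real>\<^sub>\<le>\<^sub>0"
      by (auto simp: S_def complex_nonpos_Reals_iff)
    have "Im (1 / x) \<noteq> 0" using x by (simp add: Im_divide complex_eq_iff)
    note nin = not_in_slit(1)[OF this]
    have "((\<lambda>x. 1 / x) has_field_derivative (- 1 / x ^ 2)) (at x)"
      using x by (auto intro!: derivative_eq_intros simp: power2_eq_square)
    hence d2: "((\<lambda>x. dilog (1 / x)) has_field_derivative (- Ln (1 - 1 / x) / (1 / x) * (- 1 / x ^ 2))) (at x)"
      using DERIV_chain2[where g = "\<lambda>x. 1 / x" and f = dilog] has_field_derivative_dilog[OF nin x(3)]
      by blast
    have d3: "((\<lambda>x. (Ln x + \<i> * of_real pi) ^ 2 / 2) has_field_derivative (Ln x + \<i> * of_real pi) / x) (at x)"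
      using x by (auto intro!: derivative_eq_intros simp: field_simps)
    have "(dilog has_field_derivative - Ln (1 - x) / x) (at x)"
      using x by (intro has_field_derivative_dilog not_in_slit) auto
    from DERIV_add[OF DERIV_add[OF this d2] d3]
    have "(F has_field_derivative (- Ln (1 - x) / x + - Ln (1 - 1 / x) / (1 / x) * (- 1 / x ^ 2)
        + (Ln x + \<i> * of_real pi) / x)) (at x)"
      unfolding F_def .
    also have "- Ln (1 - x) / x + - Ln (1 - 1 / x) / (1 / x) * (- 1 / x ^ 2)
        + (Ln x + \<i> * of_real pi) / x = 0"
      unfolding Ln_one_minus_inverse[OF x(1)] using x by (simp add: field_simps power2_eq_square)
    finally show "(F has_field_derivative 0) (at x within S)"
      by (rule has_field_derivative_at_within)
  qed
  then obtain c where c: "\<And>z. Im z < 0 \<Longrightarrow> F z = c" by (auto simp: S_def)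
  have F_cis: "F (cis (- t)) = dilog (cis (- t)) + dilog (cis t) + (\<i> * of_real (pi - t)) ^ 2 / 2"
    if "0 < t" "t < pi" for t
  proof -
    have L: "Ln (cis (- t)) + \<i> * of_real pi = \<i> * of_real (pi - t)"
      using that by (subst Ln_cis) (auto simp: algebra_simps)
    show ?thesis unfolding F_def L one_divide_cis ..
  qed
  have ev: "\<forall>\<^sub>F t in at_right 0. 0 < t \<and> t < pi"
    using eventually_at_right_real[of 0 pi] by simp
  have "((\<lambda>t. dilog (cis (- t)) + dilog (cis t) + (\<i> * of_real (pi - t)) ^ 2 / 2) \<longlongrightarrow>
      dilog (cis (- 0)) + dilog (cis 0) + (\<i> * of_real (pi - 0)) ^ 2 / 2) (at_right 0)"
    by (intro tendsto_intros tendsto_dilog_cis) simp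
  moreover have "\<forall>\<^sub>F t in at_right 0.
      dilog (cis (- t)) + dilog (cis t) + (\<i> * of_real (pi - t)) ^ 2 / 2 = c"
    using ev
  proof eventually_elim
    case (elim t)
    hence "Im (cis (- t)) < 0" by (simp add: sin_gt_zero)
    thus ?case using F_cis[of t] c elim by metis
  qed
  ultimately have "((\<lambda>t. c) \<longlongrightarrow> dilog (cis (- 0)) + dilog (cis 0) + (\<i> * of_real (pi - 0)) ^ 2 / 2) (at_right (0::real))"
    by (rule Lim_transform_eventually)
  hence "c = dilog (cis (- 0)) + dilog (cis 0) + (\<i> * of_real (pi - 0)) ^ 2 / 2"
    by (simp add: tendsto_const_iff)
  also have "\<dots> = - of_real (pi ^ 2 / 6)"
    by (simp add: dilog_one power_mult_distrib)
  finally have "F z = - of_real (pi ^ 2 / 6)" using c[OF assms] by simp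
  moreover have "dilog z = F z - dilog (1 / z) - (Ln z + \<i> * of_real pi) ^ 2 / 2"
    by (simp add: F_def)
  ultimately show ?thesis by simp
qed

text \<open>On the unit circle \<open>1 / z\<close> is the conjugate of \<open>z\<close>, so
  inversion gives twice the real part. It applies for 0 < t < pi, and continuity adds the
  endpoints.\<close>

lemma Re_dilog_cis:
  assumes "0 \<le> t" "t \<le> pi"
  shows "Re (dilog (cis t)) = (pi - t) ^ 2 / 4 - pi ^ 2 / 12"
proof -
  define f where "f = (\<lambda>t. Re (dilog (cis t)) - ((pi - t) ^ 2 / 4 - pi ^ 2 / 12))"
  have "f t = 0"
  proof (rule continuous_constant_on_closure[of "{0<..<pi}" f 0 t])
    show "continuous_on (closure {0<..<pi}) f"
      unfolding f_def continuous_on_def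
      by (auto intro!: tendsto_intros tendsto_dilog_cis)
    show "t \<in> closure {0<..<pi}" using assms by simp
    fix s assume "s \<in> {0<..<pi}"
    hence s: "0 < s" "s < pi" by auto
    have "Im (cis (- s)) < 0" using s by (simp add: sin_gt_zero)
    note inv = dilog_inversion[OF this]
    have L: "Ln (cis (- s)) + \<i> * of_real pi = \<i> * of_real (pi - s)"
      using s by (subst Ln_cis) (auto simp: algebra_simps)
    have "dilog (cis (- s)) + dilog (cis s) = - of_real (pi ^ 2 / 6) - (\<i> * of_real (pi - s)) ^ 2 / 2"
      using inv unfolding L one_divide_cis by simp
    moreover have "dilog (cis (- s)) = cnj (dilog (cis s))"
      using dilog_cnj[of "cis s"] by (simp add: cis_cnj)
    ultimately have "Re (cnj (dilog (cis s)) + dilog (cis s)) =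
        Re (- of_real (pi ^ 2 / 6) - (\<i> * of_real (pi - s)) ^ 2 / 2)" by metis
    thus "f s = 0"
      by (simp add: f_def power_mult_distrib flip: of_real_diff of_real_power)
  qed
  thus ?thesis by (simp add: f_def)
qed

section \<open>Clausen's integral as the imaginary part on the unit circle\<close>

lemma norm_one_minus_cis:
  assumes "0 \<le> t" "t \<le> 2 * pi"
  shows "norm (1 - cis t) = 2 * sin (t / 2)"
proof -
  have "(norm (1 - cis t)) ^ 2 = (2 * sin (t / 2)) ^ 2"
    using cos_double_sin[of "t / 2"] sin_cos_squared_add[of t]
    unfolding cmod_power2 by (simp add: power2_eq_square algebra_simps)
  moreover have "0 \<le> 2 * sin (t / 2)"
    using assms by (simp add: sin_ge_zero)
  ultimately show ?thesis using power2_eq_imp_eq norm_ge_zero by blast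
qed

text \<open>The derivative of \<open>Im (dilog (cis x))\<close> is minus the logarithm of the
  modulus of \<open>1 - cis x\<close>, which is \<open>2 * sin (x / 2)\<close>. The remaining work
  concerns the logarithmic singularity at 0.\<close>

lemma clausen_eq_Im_dilog_pos:
  assumes "0 < \<theta>" "\<theta> \<le> pi"
  shows "clausen \<theta> = Im (dilog (cis \<theta>))"
proof -
  \<comment> \<open>The logarithm of \<open>2 * sin (x / 2)\<close> changes sign at pi / 3. Moving
    \<open>ln 2\<close> into \<open>F\<close> leaves a nonnegative integrand \<open>f\<close>, for
    which the fundamental theorem also yields integrability up to the singularity.\<close>
  define F where "F = (\<lambda>x. Im (dilog (cis x)) + x * ln 2)"
  define f where "f = (\<lambda>x::real. - ln (sin (x / 2)))"
  have pos: "0 < sin (x / 2)" if "0 < x" "x < pi" for x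
    using that by (intro sin_gt_zero) auto
  have tF: "(F \<longlongrightarrow> F a) (at a within T)" for a T
    unfolding F_def by (auto intro!: tendsto_intros tendsto_dilog_cis)
  have DF: "DERIV F x :> f x" if x: "0 < x" "x < pi" for x
  proof -
    have "Im (cis x) \<noteq> 0" using x sin_gt_zero[of x] by simp
    hence "cis x \<notin> complex_of_real ` {1..}" by (rule not_in_slit)
    moreover have "((\<lambda>x. cis x) has_vector_derivative (\<i> * cis x)) (at x)"
      unfolding has_vector_derivative_def by (auto intro!: derivative_eq_intros)
    ultimately have "((\<lambda>x. dilog (cis x)) has_vector_derivative (\<i> * cis x) * (- Ln (1 - cis x) / cis x)) (at x)"
      using field_vector_diff_chain_at[OF _ has_field_derivative_dilog, of cis "\<i> * cis x" x]
      by (simp add: o_def)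
    hence "((\<lambda>x. Im (dilog (cis x))) has_vector_derivative Im ((\<i> * cis x) * (- Ln (1 - cis x) / cis x))) (at x)"
      by (rule bounded_linear.has_vector_derivative[OF bounded_linear_Im])
    also have "Im ((\<i> * cis x) * (- Ln (1 - cis x) / cis x)) = - Re (Ln (1 - cis x))"
      by simp
    also have "1 - cis x \<noteq> 0"
      using \<open>Im (cis x) \<noteq> 0\<close> by (metis eq_iff_diff_eq_0 one_complex.sel(2))
    hence "Re (Ln (1 - cis x)) = ln (2 * sin (x / 2))"
      using x by (simp add: norm_one_minus_cis)
    finally have "DERIV (\<lambda>x. Im (dilog (cis x))) x :> - ln (2 * sin (x / 2))"
      by (simp add: has_real_derivative_iff_has_vector_derivative)
    moreover have "ln (2 * sin (x / 2)) = ln 2 + ln (sin (x / 2))"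
      using pos[OF x] by (simp add: ln_mult)
    moreover have "DERIV (\<lambda>x. x * ln 2) x :> ln 2"
      by (auto intro!: derivative_eq_intros)
    ultimately have "DERIV F x :> - (ln 2 + ln (sin (x / 2))) + ln 2"
      unfolding F_def using DERIV_add by metis
    thus ?thesis by (simp add: f_def)
  qed
  have 0: "(0::ereal) = ereal 0" by simp
  have int: "set_integrable lborel (einterval 0 \<theta>) f" "(LBINT x=0..\<theta>. f x) = F \<theta> - F 0"
  proof -
    have lt: "0 < ereal \<theta>" using assms by simp
    have D: "DERIV F x :> f x" if "0 < ereal x" "ereal x < ereal \<theta>" for x
      using that assms by (intro DF) auto
    have C: "isCont f x" if "0 < ereal x" "ereal x < ereal \<theta>" for x
      unfolding f_def using that assms pos[of x] by (intro continuous_intros) auto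
    have N: "AE x in lborel. 0 < ereal x \<longrightarrow> ereal x < ereal \<theta> \<longrightarrow> 0 \<le> f x"
    proof (intro AE_I2 impI)
      fix x assume "0 < ereal x" "ereal x < ereal \<theta>"
      hence "0 < sin (x / 2)" using assms by (intro pos) auto
      thus "0 \<le> f x" by (simp add: f_def)
    qed
    have A: "((F \<circ> real_of_ereal) \<longlongrightarrow> F 0) (at_right 0)"
      unfolding 0 ereal_tendsto_simps by (rule tF)
    have B: "((F \<circ> real_of_ereal) \<longlongrightarrow> F \<theta>) (at_left (ereal \<theta>))"
      unfolding ereal_tendsto_simps by (rule tF)
    show "set_integrable lborel (einterval 0 \<theta>) f" "(LBINT x=0..\<theta>. f x) = F \<theta> - F 0"
      using interval_integral_FTC_nonneg[OF lt D C N A B] by blast+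
  qed
  have "(LBINT x=0..\<theta>. ln \<bar>2 * sin (x / 2)\<bar>) = (LBINT x=0..\<theta>. ln 2 - f x)"
  proof (rule interval_integral_cong)
    fix x assume "x \<in> einterval (min 0 (ereal \<theta>)) (max 0 (ereal \<theta>))"
    hence "0 < x" "x < pi" using assms by (auto simp: einterval_def min_def max_def split: if_splits)
    from pos[OF this] show "ln \<bar>2 * sin (x / 2)\<bar> = ln 2 - f x"
      by (simp add: f_def ln_mult)
  qed
  also have "set_integrable lborel {0<..<\<theta>} (\<lambda>x. ln 2 :: real)"
    unfolding set_integrable_def using assms
    by (intro integrable_scaleR_left integrable_real_indicator) auto
  hence "(LBINT x=0..\<theta>. ln 2 - f x) = (LBINT x=0..\<theta>. ln 2) - (LBINT x=0..\<theta>. f x)"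
    using assms int(1)
    by (intro interval_lebesgue_integral_diff) (auto simp: interval_lebesgue_integrable_def 0)
  also have "(LBINT x=0..\<theta>. ln 2) = ln 2 * \<theta>"
    using assms by (simp add: 0)
  finally have "(LBINT x=0..\<theta>. ln \<bar>2 * sin (x / 2)\<bar>) = ln 2 * \<theta> - (F \<theta> - F 0)"
    unfolding int(2) .
  thus ?thesis
    unfolding clausen_def by (simp add: F_def dilog_one)
qed

lemma clausen_minus: "clausen (- \<theta>) = - clausen \<theta>"
proof -
  have "(LBINT x=0..-\<theta>. ln \<bar>2 * sin (x / 2)\<bar>) = (LBINT x=\<theta>..0. ln \<bar>2 * sin (x / 2)\<bar>)"
    by (subst interval_integral_reflect) (simp add: abs_mult)
  also have "\<dots> = - (LBINT x=0..\<theta>. ln \<bar>2 * sin (x / 2)\<bar>)"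
    by (rule interval_integral_endpoints_reverse)
  finally show ?thesis by (simp add: clausen_def)
qed

lemma dilog_cis:
  assumes "\<bar>\<theta>\<bar> \<le> pi"
  shows "dilog (cis \<theta>) = of_real (pi ^ 2 * bernoulli_poly2 (\<bar>\<theta>\<bar> / (2 * pi))) + \<i> * of_real (clausen \<theta>)"
proof -
  have B: "(pi - t) ^ 2 / 4 - pi ^ 2 / 12 = pi ^ 2 * bernoulli_poly2 (t / (2 * pi))" for t
    by (simp add: bernoulli_poly2_def field_simps power2_eq_square)
  consider "\<theta> = 0" | "\<theta> > 0" | "\<theta> < 0" by linarith
  thus ?thesis
  proof cases
    case 1
    thus ?thesis
      by (simp add: dilog_one bernoulli_poly2_def clausen_def flip: zero_ereal_def)
  next
    case 2
    thus ?thesis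
      using assms clausen_eq_Im_dilog_pos[of \<theta>] Re_dilog_cis[of \<theta>] B[of \<theta>]
      by (simp add: complex_eq_iff)
  next
    case 3
    have "dilog (cis \<theta>) = cnj (dilog (cis (- \<theta>)))"
      using dilog_cnj[of "cis (- \<theta>)"] by (simp add: cis_cnj)
    thus ?thesis
      using 3 assms clausen_eq_Im_dilog_pos[of "- \<theta>"] Re_dilog_cis[of "- \<theta>"] B[of "- \<theta>"]
      by (simp add: complex_eq_iff clausen_minus)
  qed
qed

subsection \<open>Elementary estimates\<close>

lemma pi_bounds: "31415 / 10000 < pi" "pi < 31416 / 10000"
  using pi_approx by auto

lemma pi_square_bounds: "986 / 100 < pi ^ 2" "pi ^ 2 < 987 / 100"
proof -
  have "(31415 / 10000) ^ 2 < pi ^ 2" "pi ^ 2 < (31416 / 10000) ^ 2"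
    using pi_bounds by (auto intro!: power_strict_mono)
  thus "986 / 100 < pi ^ 2" "pi ^ 2 < 987 / 100" by (simp_all add: power2_eq_square)
qed

text \<open>The majorant \<open>g\<close> is a primitive of \<open>k - ln x\<close>. It is
  continuous at 0 because \<open>x * ln x\<close> tends to 0 there, so the derivative of
  \<open>f\<close> may have a logarithmic singularity at 0.\<close>

lemma norm_diff_le_of_log_bound:
  fixes f :: "real \<Rightarrow> 'a::real_normed_vector"
  assumes "0 < a" and cont: "continuous_on {0..a} f"
    and der: "\<And>x. 0 < x \<Longrightarrow> x < a \<Longrightarrow> (f has_vector_derivative f' x) (at x)"
    and bnd: "\<And>x. 0 < x \<Longrightarrow> x < a \<Longrightarrow> norm (f' x) \<le> k - ln x"
  shows "norm (f a - f 0) \<le> a * (k + 1 - ln a)"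
proof -
  define g :: "real \<Rightarrow> real" where "g = (\<lambda>x. x * (k + 1) - x * ln x)"
  have x_ln_x: "((\<lambda>x::real. x * ln x) \<longlongrightarrow> 0) (at_right 0)"
    by real_asymp
  have "continuous_on {0..a} g"
  proof (rule continuous_on_eq_continuous_within[THEN iffD2], rule ballI)
    fix x assume x: "x \<in> {0..a}"
    show "continuous (at x within {0..a}) g"
    proof (cases "x = 0")
      case False
      thus ?thesis unfolding g_def using x by (intro continuous_intros) auto
    next
      case True
      have "(g \<longlongrightarrow> 0 * (k + 1) - 0) (at_right 0)"
        unfolding g_def by (intro tendsto_intros x_ln_x)
      hence "(g \<longlongrightarrow> g 0) (at 0 within {0..a})"
        using assms(1) at_within_Icc_at_right[of 0 a] by (simp add: g_def)
      thus ?thesis using True by (simp add: continuous_within)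
    qed
  qed
  moreover have "(g has_vector_derivative (k - ln x)) (at x)" if "0 < x" "x < a" for x
  proof -
    have "(g has_real_derivative (k - ln x)) (at x)"
      unfolding g_def using that by (auto intro!: derivative_eq_intros)
    thus ?thesis by (simp add: has_real_derivative_iff_has_vector_derivative)
  qed
  ultimately have "norm (f a - f 0) \<le> g a - g 0"
    using assms by (intro differentiable_bound_general[where f' = f' and \<phi>' = "\<lambda>x. k - ln x"]) auto
  thus ?thesis by (simp add: g_def algebra_simps)
qed

text \<open>The best possible slope is 1 / e; 2 / 5 is a rational slightly above it.\<close>

lemma ln_le_two_fifths:
  assumes "0 < (x::real)"
  shows "ln x \<le> 2 / 5 * x"
proof -
  have "1 + 1 + 1\<^sup>2 / 2 \<le> exp (1::real)"
    by (rule exp_lower_Taylor_quadratic) simp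
  hence "1 \<le> ln (exp 1 :: real)" "5 / 2 \<le> exp (1::real)" by auto
  hence "ln (5 / 2 :: real) \<le> 1"
    by (metis ln_exp ln_le_cancel_iff exp_gt_zero zero_less_divide_iff zero_less_numeral)
  have "ln x = ln (2 / 5 * x) + ln (5 / 2)"
    using assms ln_mult[of "2 / 5 * x" "5 / 2"] by simp
  also have "ln (2 / 5 * x) \<le> 2 / 5 * x - 1"
    using assms by (intro ln_le_minus_one) auto
  finally show ?thesis using \<open>ln (5 / 2 :: real) \<le> 1\<close> by simp
qed

text \<open>A rational version of the tangent at e^2, with (2 / 5)^2 in place of e^(-2). The smaller
  slope is what the Newton constant for \<open>A = 0\<close> can afford.\<close>

lemma ln_le_affine:
  assumes "0 < (y::real)"
  shows "ln y \<le> 4 / 25 * y + 1"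
proof -
  have "ln y = ln (4 / 25 * y) + 2 * ln (5 / 2)"
  proof -
    have "ln y = ln (4 / 25 * y * (5 / 2 * (5 / 2)))" by simp
    also have "\<dots> = ln (4 / 25 * y) + ln (5 / 2 * (5 / 2))" using assms by (intro ln_mult_pos) auto
    also have "ln (5 / 2 * (5 / 2) :: real) = ln (5 / 2) + ln (5 / 2)" by (intro ln_mult_pos) auto
    finally show ?thesis by simp
  qed
  moreover have "ln (5 / 2 :: real) \<le> 2 / 5 * (5 / 2)" by (rule ln_le_two_fifths) simp
  moreover have "ln (4 / 25 * y) \<le> 4 / 25 * y - 1" using assms by (intro ln_le_minus_one) auto
  ultimately show ?thesis by simp
qed

lemma sin_ge_cubic:
  assumes "0 \<le> (y::real)"
  shows "y - y ^ 3 / 6 \<le> sin y"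
proof -
  have "\<bar>sin y - (\<Sum>m<3. sin_coeff m * y ^ m)\<bar> \<le> inverse (fact 3) * \<bar>y\<bar> ^ 3"
    by (rule Maclaurin_sin_bound)
  moreover have "(\<Sum>m<3. sin_coeff m * y ^ m) = y"
    by (simp add: eval_nat_numeral sin_coeff_def)
  moreover have "inverse (fact 3) * \<bar>y\<bar> ^ 3 = y ^ 3 / 6"
    using assms by (simp add: fact_numeral)
  ultimately show ?thesis by linarith
qed

lemma norm_Ln_le: "z \<noteq> 0 \<Longrightarrow> norm (Ln z) \<le> \<bar>ln (norm z)\<bar> + \<bar>Im (Ln z)\<bar>"
  using cmod_le[of "Ln z"] by simp

lemma abs_Im_Ln_le_pi: "z \<noteq> 0 \<Longrightarrow> \<bar>Im (Ln z)\<bar> \<le> pi"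
  using Im_Ln_le_pi[of z] mpi_less_Im_Ln[of z] by auto

lemma norm_Ln_one_minus_le:
  assumes "Re z \<le> 0"
  shows "norm (Ln (1 - z)) \<le> norm z"
proof -
  have "norm (Ln (1 - z) - Ln (1 - 0)) \<le> 1 * norm (z - 0)"
  proof (rule field_differentiable_bound[of "{z. Re z \<le> 0}"])
    fix x :: complex assume x: "x \<in> {z. Re z \<le> 0}"
    hence "1 - x \<notin> \<real>\<^sub>\<le>\<^sub>0" by (auto simp: complex_nonpos_Reals_iff)
    thus "((\<lambda>x. Ln (1 - x)) has_field_derivative - 1 / (1 - x)) (at x within {z. Re z \<le> 0})"
      by (auto intro!: derivative_eq_intros simp: field_simps)
    have "1 \<le> Re (1 - x)" using x by simp
    also have "\<dots> \<le> norm (1 - x)" by (rule complex_Re_le_cmod)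
    finally show "norm (- 1 / (1 - x)) \<le> 1" by (simp add: norm_divide divide_le_eq_1)
  qed (use assms in \<open>auto simp: convex_halfspace_Re_le\<close>)
  thus ?thesis by simp
qed

lemma norm_exp_diff_le:
  assumes "Re x \<le> 0" "Re y \<le> 0"
  shows "norm (exp x - exp y) \<le> norm (x - y :: complex)"
proof -
  have "norm (exp x - exp y) \<le> 1 * norm (x - y)"
    by (rule field_differentiable_bound[of "{z. Re z \<le> 0}" exp exp])
       (use assms in \<open>auto simp: convex_halfspace_Re_le intro: has_field_derivative_at_within\<close>)
  thus ?thesis by simp
qed

lemma norm_exp_minus_linear_le:
  assumes "Re z \<le> 0"
  shows "norm (exp z - 1 - z) \<le> norm z ^ 2"
proof -
  have "norm ((exp z - z) - (exp 0 - 0)) \<le> norm z * norm (z - 0)"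
  proof (rule field_differentiable_bound[of "closed_segment 0 z"])
    fix x assume "x \<in> closed_segment 0 z"
    then obtain u where u: "0 \<le> u" "u \<le> 1" "x = of_real u * z"
      by (auto simp: in_segment scaleR_conv_of_real)
    show "((\<lambda>z. exp z - z) has_field_derivative exp x - 1) (at x within closed_segment 0 z)"
      by (auto intro!: derivative_eq_intros)
    have "Re x \<le> 0" using u assms by (simp add: mult_nonneg_nonpos)
    hence "norm (exp x - exp 0) \<le> norm (x - 0)" by (intro norm_exp_diff_le) auto
    also have "\<dots> \<le> norm z" using u by (simp add: norm_mult mult_left_le_one_le)
    finally show "norm (exp x - 1) \<le> norm z" by simp
  qed auto
  thus ?thesis by (simp add: power2_eq_square algebra_simps)
qed

lemma norm_exp_minus_one_le: "norm (exp z - 1) \<le> exp (norm z) * norm (z::complex)"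
proof -
  have "norm (exp z - exp 0) \<le> exp (norm z) * norm (z - 0)"
  proof (rule field_differentiable_bound[of "cball 0 (norm z)"])
    fix x :: complex assume "x \<in> cball 0 (norm z)"
    hence "norm x \<le> norm z" by simp
    thus "norm (exp x) \<le> exp (norm z)"
      using norm_exp[of x] by (meson exp_le_cancel_iff order_trans)
  qed (auto intro: has_field_derivative_at_within)
  thus ?thesis by simp
qed

subsection \<open>Newton's method\<close>

text \<open>The error after a step is the first-order Taylor remainder of \<open>f\<close> at
  \<open>c\<close>, evaluated at the zero, divided by \<open>f' c\<close>. Derivatives are taken
  within \<open>S\<close>, so that \<open>c\<close> may lie on the boundary of
  \<open>S\<close>.\<close>

lemma newton_error:
  fixes f f' :: "complex \<Rightarrow> complex"
  assumes S: "convex S" "\<rho> \<in> S" "c \<in> S"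
    and der: "\<And>z. z \<in> S \<Longrightarrow> (f has_field_derivative f' z) (at z within S)"
    and lip: "\<And>x y. x \<in> S \<Longrightarrow> y \<in> S \<Longrightarrow> norm (f' x - f' y) \<le> M * norm (x - y)"
    and zero: "f \<rho> = 0" and m: "0 < m" "m \<le> norm (f' c)"
  shows "norm (c - f c / f' c - \<rho>) \<le> M / (2 * m) * norm (c - \<rho>) ^ 2"
proof -
  define p where "p = (\<lambda>t. c + of_real t * (\<rho> - c))"
  define h where "h = (\<lambda>t. f (p t) - of_real t * (f' c * (\<rho> - c)))"
  have pS: "p t \<in> S" if "t \<in> {0..1}" for t
    using convexD_alt[OF S(1) S(3,2), of t] that
    by (simp add: p_def scaleR_conv_of_real algebra_simps)
  have h_der: "(h has_vector_derivative ((\<rho> - c) * f' (p t) - f' c * (\<rho> - c))) (at t within {0..1})"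
    if t: "t \<in> {0..1}" for t
  proof -
    have "(p has_vector_derivative (\<rho> - c)) (at t within {0..1})"
      unfolding p_def by (auto intro!: derivative_eq_intros)
    moreover have "(f has_field_derivative f' (p t)) (at (p t) within p ` {0..1})"
      using der[OF pS[OF t]] by (rule DERIV_subset) (use pS in auto)
    ultimately have "((\<lambda>t. f (p t)) has_vector_derivative ((\<rho> - c) * f' (p t))) (at t within {0..1})"
      using field_vector_diff_chain_within[of p "\<rho> - c" t "{0..1}" f "f' (p t)"] by (simp add: o_def)
    thus ?thesis unfolding h_def by (auto intro!: derivative_eq_intros)
  qed
  \<comment> \<open>A majorant quadratic in \<open>t\<close> gives the factor 1 / 2 of the Taylor
    remainder, which a plain mean value bound would lose.\<close>
  have "norm (h 1 - h 0) \<le> M * norm (\<rho> - c) ^ 2 * 1 ^ 2 / 2 - M * norm (\<rho> - c) ^ 2 * 0 ^ 2 / 2"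
  proof (rule differentiable_bound_general[where \<phi> = "\<lambda>t. M * norm (\<rho> - c) ^ 2 * t ^ 2 / 2"
        and \<phi>' = "\<lambda>t. M * norm (\<rho> - c) ^ 2 * t"])
    show "continuous_on {0..1} h"
      using h_der by (meson continuous_on_vector_derivative)
    fix t :: real assume t: "0 < t" "t < 1"
    show "(h has_vector_derivative ((\<rho> - c) * f' (p t) - f' c * (\<rho> - c))) (at t)"
      using h_der[of t] t by (simp add: at_within_Icc_at)
    have "((\<lambda>t. M * norm (\<rho> - c) ^ 2 * t ^ 2 / 2) has_real_derivative M * norm (\<rho> - c) ^ 2 * t) (at t)"
      by (auto intro!: derivative_eq_intros)
    thus "((\<lambda>t. M * norm (\<rho> - c) ^ 2 * t ^ 2 / 2) has_vector_derivative M * norm (\<rho> - c) ^ 2 * t) (at t)"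
      by (simp add: has_real_derivative_iff_has_vector_derivative)
    have "norm ((\<rho> - c) * f' (p t) - f' c * (\<rho> - c)) = norm (\<rho> - c) * norm (f' (p t) - f' c)"
      by (simp add: algebra_simps flip: norm_mult)
    also have "\<dots> \<le> norm (\<rho> - c) * (M * norm (p t - c))"
      using t by (intro mult_left_mono lip pS S) auto
    also have "norm (p t - c) = t * norm (\<rho> - c)"
      using t by (simp add: p_def norm_mult)
    finally show "norm ((\<rho> - c) * f' (p t) - f' c * (\<rho> - c)) \<le> M * norm (\<rho> - c) ^ 2 * t"
      by (simp add: power2_eq_square mult_ac)
  qed (auto intro!: continuous_intros)
  hence *: "norm (f c + f' c * (\<rho> - c)) \<le> M * norm (c - \<rho>) ^ 2 / 2"
    by (simp add: h_def p_def zero norm_minus_commute algebra_simps)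
  have nz: "f' c \<noteq> 0" using m by auto
  have "norm (c - f c / f' c - \<rho>) = norm (f c + f' c * (\<rho> - c)) / norm (f' c)"
  proof -
    have "c - f c / f' c - \<rho> = - ((f c + f' c * (\<rho> - c)) / f' c)"
      using nz by (simp add: field_simps)
    thus ?thesis by (simp only: norm_minus_cancel norm_divide)
  qed
  also have "\<dots> \<le> (M * norm (c - \<rho>) ^ 2 / 2) / m"
    using * m order_trans[OF norm_ge_zero *] by (intro frac_le) auto
  finally show ?thesis by (simp add: field_simps)
qed

text \<open>The errors decrease, so every iterate after the initial one lies in the ball of radius
  \<open>K * norm (c 0 - \<rho>) ^ 2\<close> about the zero. Only this smaller ball has to fit into
  \<open>S\<close>; the initial value itself may be a boundary point.\<close>

lemma newton_converges:
  fixes c :: "nat \<Rightarrow> complex"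
  assumes step: "\<And>n. c n \<in> S \<Longrightarrow> norm (c (Suc n) - \<rho>) \<le> K * norm (c n - \<rho>) ^ 2"
    and c0: "c 0 \<in> S" and K: "K * norm (c 0 - \<rho>) < 1" "0 \<le> K"
    and S: "cball \<rho> (K * norm (c 0 - \<rho>) ^ 2) \<subseteq> S"
  shows "c n \<in> S" "converges_quadratically c \<rho>"
proof -
  define q where "q = K * norm (c 0 - \<rho>)"
  have q: "0 \<le> q" "q < 1" using K by (auto simp: q_def)
  have *: "c n \<in> S \<and> norm (c n - \<rho>) \<le> q ^ n * norm (c 0 - \<rho>)" for n
  proof (induction n)
    case 0
    thus ?case using c0 by simp
  next
    case (Suc n)
    have "q ^ n * norm (c 0 - \<rho>) \<le> 1 * norm (c 0 - \<rho>)"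
      using q by (intro mult_right_mono power_le_one) auto
    hence le: "norm (c n - \<rho>) \<le> norm (c 0 - \<rho>)" using Suc by simp
    have "norm (c (Suc n) - \<rho>) \<le> K * norm (c n - \<rho>) * norm (c n - \<rho>)"
      using step[of n] Suc by (simp add: power2_eq_square)
    also have "\<dots> \<le> K * norm (c 0 - \<rho>) * norm (c n - \<rho>)"
      using le K by (intro mult_right_mono mult_left_mono) auto
    finally have s: "norm (c (Suc n) - \<rho>) \<le> q * norm (c n - \<rho>)"
      by (simp add: q_def)
    also have "\<dots> \<le> q * (q ^ n * norm (c 0 - \<rho>))"
      using Suc q by (intro mult_left_mono) auto
    finally have "norm (c (Suc n) - \<rho>) \<le> q ^ Suc n * norm (c 0 - \<rho>)" by simp
    moreover have "q * norm (c n - \<rho>) \<le> K * norm (c 0 - \<rho>) ^ 2"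
      using mult_left_mono[OF le q(1)] by (simp add: q_def power2_eq_square mult_ac)
    hence "c (Suc n) \<in> cball \<rho> (K * norm (c 0 - \<rho>) ^ 2)"
      using s by (simp add: dist_norm norm_minus_commute)
    ultimately show ?case using S by auto
  qed
  thus "c n \<in> S" by blast
  have "(\<lambda>n. q ^ n * norm (c 0 - \<rho>)) \<longlonglongrightarrow> 0 * norm (c 0 - \<rho>)"
    using q by (intro tendsto_intros LIMSEQ_power_zero) auto
  hence "(\<lambda>n. q ^ n * norm (c 0 - \<rho>)) \<longlonglongrightarrow> 0" by simp
  hence "(\<lambda>n. c n - \<rho>) \<longlonglongrightarrow> 0"
    by (rule Lim_null_comparison[OF always_eventually[OF allI[OF conjunct2[OF *]]]])
  hence "c \<longlonglongrightarrow> \<rho>" by (rule LIM_zero_cancel)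
  thus "converges_quadratically c \<rho>"
    unfolding converges_quadratically_def using step[OF conjunct1[OF *]] by (intro conjI exI[of _ K] allI)
qed

subsection \<open>Derivatives and location of the zeros\<close>

text \<open>The branch on the right has its cut on the negative imaginary axis and is therefore
  analytic at the negative reals.\<close>

lemma Ln_rotate:
  assumes "0 \<le> Im z" "z \<noteq> 0"
  shows "Ln z = Ln (- \<i> * z) + \<i> * of_real pi / 2"
  using Ln_times_ii[of "- \<i> * z"] assms by simp

text \<open>On the closed upper half-plane \<open>phi\<close> agrees with a branch that is analytic across the
  negative axis. Hence one-sided derivatives exist there, as needed for \<open>B = 2 A\<close>, where the
  initial value is -1.\<close>

lemma phi_has_field_derivative:
  assumes S: "S \<subseteq> {z. 0 \<le> Im z} \<or> S \<subseteq> {z. Im z < 0}"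
    and S0: "0 \<notin> S" and z: "z \<in> S" "z \<notin> complex_of_real ` {1..}"
  shows "(phi A B has_field_derivative dphi A B z) (at z within S)"
proof -
  have z0: "z \<noteq> 0" using z S0 by auto
  have *: "((\<lambda>z. dilog z + 4 * of_real pi ^ 2 * of_int A + 2 * of_real pi * \<i> * of_int B * L z)
      has_field_derivative dphi A B z) (at z)" if "(L has_field_derivative 1 / z) (at z)" for L
  proof -
    have "((\<lambda>z. dilog z + 4 * of_real pi ^ 2 * of_int A + 2 * of_real pi * \<i> * of_int B * L z)
      has_field_derivative (- Ln (1 - z) / z + 0 + 2 * of_real pi * \<i> * of_int B * (1 / z))) (at z)"
      by (intro DERIV_add DERIV_cmult has_field_derivative_dilog that z z0 DERIV_const)
    thus ?thesis by (simp add: dphi_def add_divide_distrib diff_divide_distrib)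
  qed
  from S show ?thesis
  proof
    assume S: "S \<subseteq> {z. 0 \<le> Im z}"
    have "0 \<le> Im z" using S z by auto
    hence "- \<i> * z \<notin> \<real>\<^sub>\<le>\<^sub>0" using z0 by (auto simp: complex_nonpos_Reals_iff complex_eq_iff)
    hence "((\<lambda>z. Ln (- \<i> * z) + \<i> * of_real pi / 2) has_field_derivative 1 / z) (at z)"
      using z0 by (auto intro!: derivative_eq_intros simp: field_simps)
    from has_field_derivative_at_within[OF *[OF this]] show ?thesis
    proof (rule has_field_derivative_transform_within[OF _ zero_less_one z(1)])
      fix x assume "x \<in> S"
      hence "Ln x = Ln (- \<i> * x) + \<i> * of_real pi / 2"
        using S S0 by (intro Ln_rotate) auto
      thus "dilog x + 4 * of_real pi ^ 2 * of_int A + 2 * of_real pi * \<i> * of_int B *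
          (Ln (- \<i> * x) + \<i> * of_real pi / 2) = phi A B x"
        unfolding phi_def by simp
    qed
  next
    assume "S \<subseteq> {z. Im z < 0}"
    hence "z \<notin> \<real>\<^sub>\<le>\<^sub>0" using z by (auto simp: complex_nonpos_Reals_iff)
    hence "(Ln has_field_derivative 1 / z) (at z)"
      using has_field_derivative_Ln by (simp add: inverse_eq_divide)
    from *[OF this] show ?thesis
      unfolding phi_def [abs_def] by (rule has_field_derivative_at_within)
  qed
qed

lemma Im_Ln_one_minus:
  shows "0 \<le> Im z \<Longrightarrow> z \<notin> complex_of_real ` {1..} \<Longrightarrow> Im (Ln (1 - z)) \<le> 0"
    and "Im z < 0 \<Longrightarrow> Im (Ln (1 - z)) < pi"
proof -
  show "Im (Ln (1 - z)) < pi" if "Im z < 0"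
    using Im_Ln_pos_lt_imp[of "1 - z"] that by simp
  assume z: "0 \<le> Im z" "z \<notin> complex_of_real ` {1..}"
  hence nz: "1 - z \<noteq> 0" "1 - z \<notin> \<real>\<^sub>\<le>\<^sub>0"
    using one_minus_in_nonpos_Reals_iff by auto
  show "Im (Ln (1 - z)) \<le> 0"
  proof (rule ccontr)
    assume c: "\<not> Im (Ln (1 - z)) \<le> 0"
    hence "0 < Im (1 - z)"
      using Im_Ln_pos_lt[of "1 - z"] nz Im_Ln_less_pi[of "1 - z"] by auto
    thus False using z by simp
  qed
qed

text \<open>Only the imaginary part \<open>2 pi B - arg (1 - z)\<close> is used. The argument is
  nonpositive over the closed upper half-plane and costs less than pi over the lower one.\<close>

lemma norm_dphi_numerator_ge:
  fixes B :: int
  shows "0 \<le> Im z \<Longrightarrow> z \<notin> complex_of_real ` {1..} \<Longrightarrow>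
      2 * pi * B \<le> norm (- Ln (1 - z) + 2 * of_real pi * \<i> * of_int B)"
    and "Im z < 0 \<Longrightarrow> 2 * pi * B - pi \<le> norm (- Ln (1 - z) + 2 * of_real pi * \<i> * of_int B)"
  using abs_Im_le_cmod[of "- Ln (1 - z) + 2 * of_real pi * \<i> * of_int B"] Im_Ln_one_minus[of z]
  by auto

text \<open>The derivative of \<open>dphi A B\<close> is
  \<open>(1 / (1 - z) - dphi A B z) / z\<close>, which the data \<open>d\<close>, \<open>r\<close>,
  \<open>L\<close> bound by the Lipschitz constant \<open>M\<close>; \<open>m / R\<close> bounds
  \<open>dphi A B\<close> from below. The hypothesis on \<open>K\<close> compares \<open>K\<close>
  with the Newton factor formed from these two. Each case below only has to supply a region and
  numbers.\<close>

lemma newton_seq_converges: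
  fixes A B :: int and S :: "complex set"
  assumes B: "0 < B"
    and S: "convex S" "S \<subseteq> {z. 0 \<le> Im z} \<or> S \<subseteq> {z. Im z < 0}"
    and slit: "\<And>z. z \<in> S \<Longrightarrow> z \<notin> complex_of_real ` {1..}"
    and d: "0 < d" "\<And>z. z \<in> S \<Longrightarrow> d \<le> norm (1 - z)"
    and r: "0 < r" "\<And>z. z \<in> S \<Longrightarrow> r \<le> norm z"
    and R: "\<And>z. z \<in> S \<Longrightarrow> norm z \<le> R"
    and L: "\<And>z. z \<in> S \<Longrightarrow> norm (Ln (1 - z)) \<le> L"
    and m: "0 < m" "\<And>z. z \<in> S \<Longrightarrow> m \<le> norm (- Ln (1 - z) + 2 * of_real pi * \<i> * of_int B)"
    and K: "R / (2 * m) * ((1 / d + (2 * pi * B + L) / r) / r) \<le> K"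
    and \<rho>: "\<rho> \<in> S" "phi A B \<rho> = 0"
    and c0: "newton_seq A B 0 \<in> S" "K * norm (newton_seq A B 0 - \<rho>) < 1"
    and ball: "cball \<rho> (K * norm (newton_seq A B 0 - \<rho>) ^ 2) \<subseteq> S"
  shows "newton_seq A B n \<noteq> 0 \<and> newton_seq A B n \<noteq> 1 \<and> dphi A B (newton_seq A B n) \<noteq> 0"
    and "converges_quadratically (newton_seq A B) \<rho>"
proof -
  define M where "M = (1 / d + (2 * pi * B + L) / r) / r"
  have "0 \<le> L" using L[OF \<rho>(1)] norm_ge_zero order_trans by blast
  have "0 < R" using R[OF \<rho>(1)] r(2)[OF \<rho>(1)] r(1) by linarith
  have "0 \<le> M" unfolding M_def using d r B \<open>0 \<le> L\<close> by simp
  have S0: "0 \<notin> S" using r by force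
  have S1: "1 \<notin> S" using d by force
  have num: "norm (- Ln (1 - z) + 2 * of_real pi * \<i> * of_int B) \<le> 2 * pi * B + L" if "z \<in> S" for z
  proof -
    have "norm (- Ln (1 - z) + 2 * of_real pi * \<i> * of_int B) \<le>
        norm (- Ln (1 - z)) + norm (2 * of_real pi * \<i> * of_int B)" by (rule norm_triangle_ineq)
    also have "norm (2 * of_real pi * \<i> * of_int B) = 2 * pi * B"
      using B by (simp add: norm_mult)
    finally show ?thesis using L[OF that] by simp
  qed
  have norm_dphi: "norm (dphi A B z) = norm (- Ln (1 - z) + 2 * of_real pi * \<i> * of_int B) / norm z" for z
    by (simp add: dphi_def norm_divide)
  have lip: "norm (dphi A B x - dphi A B y) \<le> M * norm (x - y)" if "x \<in> S" "y \<in> S" for x y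
  proof (rule field_differentiable_bound[OF S(1) _ _ that])
    fix z assume z: "z \<in> S"
    hence nz: "z \<noteq> 0" "1 - z \<noteq> 0" "1 - z \<notin> \<real>\<^sub>\<le>\<^sub>0"
      using S0 S1 slit[OF z] one_minus_in_nonpos_Reals_iff by auto
    have "((\<lambda>z. - Ln (1 - z) + 2 * of_real pi * \<i> * of_int B) has_field_derivative 1 / (1 - z)) (at z)"
      using nz by (auto intro!: derivative_eq_intros simp: field_simps)
    from DERIV_divide[OF this DERIV_ident nz(1)]
    have "(dphi A B has_field_derivative (1 / (1 - z) * z -
        (- Ln (1 - z) + 2 * of_real pi * \<i> * of_int B) * 1) / (z * z)) (at z)"
      unfolding dphi_def [abs_def] .
    also have "(1 / (1 - z) * z - (- Ln (1 - z) + 2 * of_real pi * \<i> * of_int B) * 1) / (z * z) =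
        (1 / (1 - z) - dphi A B z) / z"
      unfolding dphi_def using nz by (simp add: field_simps)
    finally show "(dphi A B has_field_derivative (1 / (1 - z) - dphi A B z) / z) (at z within S)"
      by (rule has_field_derivative_at_within)
    have "norm (1 / (1 - z)) \<le> 1 / d"
      using d(1) d(2)[OF z] by (simp add: norm_divide frac_le)
    moreover have "norm (dphi A B z) \<le> (2 * pi * B + L) / r"
      unfolding norm_dphi using num[OF z] r(1) r(2)[OF z] B \<open>0 \<le> L\<close> by (intro frac_le) auto
    ultimately have "norm (1 / (1 - z) - dphi A B z) \<le> 1 / d + (2 * pi * B + L) / r"
      using norm_triangle_ineq4[of "1 / (1 - z)" "dphi A B z"] by linarith
    thus "norm ((1 / (1 - z) - dphi A B z) / z) \<le> M"
      unfolding M_def norm_divide using r(1) r(2)[OF z] d(1) B \<open>0 \<le> L\<close> by (intro frac_le) auto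
  qed
  have low: "m / R \<le> norm (dphi A B z)" if "z \<in> S" for z
    unfolding norm_dphi using m(1) m(2)[OF that] R[OF that] r(1) r(2)[OF that]
    by (intro frac_le) auto
  have "0 < m / R" using m(1) \<open>0 < R\<close> by simp
  have "M / (2 * (m / R)) \<le> K" using K by (simp add: M_def mult_ac)
  have "0 \<le> K"
    using \<open>M / (2 * (m / R)) \<le> K\<close> \<open>0 \<le> M\<close> \<open>0 < m / R\<close>
    by (meson divide_nonneg_pos mult_pos_pos order_trans zero_less_numeral)
  have step: "norm (newton_seq A B (Suc n) - \<rho>) \<le> K * norm (newton_seq A B n - \<rho>) ^ 2"
    if n: "newton_seq A B n \<in> S" for n
  proof -
    have "norm (newton_seq A B (Suc n) - \<rho>) \<le>
        M / (2 * (m / R)) * norm (newton_seq A B n - \<rho>) ^ 2"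
      unfolding newton_seq.simps
      by (rule newton_error[OF S(1) \<rho>(1) n phi_has_field_derivative[OF S(2) S0 _ slit] lip
            \<rho>(2) \<open>0 < m / R\<close> low[OF n]])
    also have "\<dots> \<le> K * norm (newton_seq A B n - \<rho>) ^ 2"
      by (intro mult_right_mono \<open>M / (2 * (m / R)) \<le> K\<close>) auto
    finally show ?thesis .
  qed
  note conv = newton_converges[OF step c0 \<open>0 \<le> K\<close> ball]
  show "converges_quadratically (newton_seq A B) \<rho>" by (rule conv(2))
  have "newton_seq A B n \<in> S" by (rule conv(1))
  with low[OF this] \<open>0 < m / R\<close> S0 S1
  show "newton_seq A B n \<noteq> 0 \<and> newton_seq A B n \<noteq> 1 \<and> dphi A B (newton_seq A B n) \<noteq> 0"
    by auto
qed

section \<open>Location of the zeros\<close>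

lemma phi_eq_0_iff:
  "phi A B \<rho> = 0 \<longleftrightarrow>
     Re (dilog \<rho>) + 4 * pi ^ 2 * A - 2 * pi * B * Im (Ln \<rho>) = 0 \<and>
     Im (dilog \<rho>) + 2 * pi * B * Re (Ln \<rho>) = 0"
  by (auto simp: phi_def complex_eq_iff simp flip: of_real_power)

lemma Ln_zero_eq:
  assumes "phi A B \<rho> = 0" "B > 0"
  shows "Ln \<rho> - \<i> * of_real (2 * pi * A / B) = \<i> * dilog \<rho> / of_real (2 * pi * B)"
proof -
  have "of_int B \<noteq> (0::complex)" using assms by simp
  have dl: "dilog \<rho> = - 4 * of_real pi ^ 2 * of_int A - 2 * of_real pi * \<i> * of_int B * Ln \<rho>"
  proof -
    have "dilog \<rho> = phi A B \<rho> - 4 * of_real pi ^ 2 * of_int A - 2 * of_real pi * \<i> * of_int B * Ln \<rho>"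
      by (simp add: phi_def)
    thus ?thesis by (simp add: assms(1))
  qed
  show ?thesis
    unfolding dl using \<open>of_int B \<noteq> 0\<close> by (simp add: field_simps power2_eq_square)
qed

text \<open>The right-hand side of the inversion formula extends continuously from the lower
  half-plane to \<open>X\<close>, since \<open>1 / X\<close> is off the slit and \<open>X\<close> is
  off the cut of \<open>Ln\<close>. The imaginary part comes from the square of
  \<open>ln x + i pi\<close>.\<close>

lemma dilog_on_slit:
  assumes "1 < x"
  shows "Im (dilog (of_real x)) = - pi * ln x"
proof -
  define X where "X = complex_of_real x"
  define F where "F = at X within {w. Im w < 0}"
  define g where "g = (\<lambda>w. - dilog (1 / w) - of_real (pi ^ 2 / 6) - (Ln w + \<i> * of_real pi) ^ 2 / 2)"
  have X: "X \<noteq> 0" "X \<notin> \<real>\<^sub>\<le>\<^sub>0" using assms by (auto simp: X_def)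
  have "Re (1 / X) < 1" unfolding X_def using assms by (simp add: Re_divide power2_eq_square)
  hence c: "isCont dilog (1 / X)"
    by (intro DERIV_isCont[OF has_field_derivative_dilog'] not_in_slit)
  have id: "((\<lambda>w. w) \<longlongrightarrow> X) F" unfolding F_def by (rule tendsto_ident_at)
  have "((\<lambda>w. dilog (1 / w)) \<longlongrightarrow> dilog (1 / X)) F"
    by (rule isCont_tendsto_compose[OF c]) (intro tendsto_intros id X)
  hence "(g \<longlongrightarrow> g X) F"
    unfolding g_def by (intro tendsto_intros id X tendsto_Ln) auto
  moreover have "\<forall>\<^sub>F w in F. g w = dilog_integral w"
    unfolding F_def eventually_at_filter
  proof (intro always_eventually allI impI)
    fix w :: complex assume "w \<in> {w. Im w < 0}"
    hence w: "Im w < 0" by simp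
    show "g w = dilog_integral w"
      unfolding g_def dilog_inversion[OF w, symmetric]
      using dilog_integral_eq_dilog not_in_slit(1)[of w] w by simp
  qed
  ultimately have "(dilog_integral \<longlongrightarrow> g X) F" by (rule Lim_transform_eventually)
  moreover have "F \<noteq> bot"
  proof -
    have "X islimpt {w. Im w < 0}"
    proof (rule islimptI)
      fix T assume "X \<in> T" "open T"
      then obtain e where e: "0 < e" "ball X e \<subseteq> T" by (auto simp: open_contains_ball)
      have "X - \<i> * of_real (e / 2) \<in> ball X e" using e by (simp add: dist_norm norm_mult)
      moreover have "Im (X - \<i> * of_real (e / 2)) < 0" using e by (simp add: X_def)
      ultimately show "\<exists>y\<in>{w. Im w < 0}. y \<in> T \<and> y \<noteq> X"
        using e by (intro bexI[of _ "X - \<i> * of_real (e / 2)"]) auto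
    qed
    thus ?thesis unfolding F_def by (simp add: trivial_limit_within)
  qed
  ultimately have "Lim F dilog_integral = g X" by (intro tendsto_Lim) auto
  hence "dilog X = g X" using assms by (simp add: dilog_def F_def X_def)
  moreover have "Im (dilog (1 / X)) = 0"
    using Im_dilog_real[of "1 / x"] assms by (simp add: X_def)
  moreover have "Ln X = of_real (ln x)" unfolding X_def using assms by (simp add: Ln_of_real)
  ultimately show ?thesis by (simp add: g_def X_def power2_eq_square)
qed

text \<open>Beyond 1 the imaginary equation reads \<open>pi * ln x * (2 * B - 1) = 0\<close>. Below
  1 the dilogarithm is real, which leaves only -1. At 1 and at -1 the real equation becomes an
  equation between integers that fails modulo 24.\<close>

lemma zero_not_real:
  assumes "B > 0" "phi A B \<rho> = 0" "\<rho> \<noteq> 0"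
  shows "Im \<rho> \<noteq> 0"
proof
  assume "Im \<rho> = 0"
  then obtain x where x: "\<rho> = of_real x" by (metis complex_is_Real_iff Reals_cases)
  have x0: "x \<noteq> 0" using assms x by auto
  have re: "Re (Ln \<rho>) = ln \<bar>x\<bar>" using x x0 by simp
  have eq: "Re (dilog \<rho>) + 4 * pi ^ 2 * A - 2 * pi * B * Im (Ln \<rho>) = 0"
    "Im (dilog \<rho>) + 2 * pi * B * ln \<bar>x\<bar> = 0"
    using assms(2) unfolding phi_eq_0_iff re by auto
  consider "1 < x" | "x = 1" | "x < 1" by linarith
  thus False
  proof cases
    case 1
    have "pi * ln x * (2 * B - 1) = 0"
      using eq(2) dilog_on_slit[OF 1] 1 by (simp add: x algebra_simps)
    thus False using 1 assms(1) by auto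
  next
    case 2
    have "pi ^ 2 * (1 + 24 * real_of_int A) = 0"
      using eq(1) 2 by (simp add: x dilog_one field_simps)
    hence "1 + 24 * real_of_int A = 0" by simp
    hence "1 + 24 * A = 0" by linarith
    thus False by presburger
  next
    case 3
    hence "ln \<bar>x\<bar> = 0"
      using eq(2) Im_dilog_real[OF 3] assms(1) by (simp add: x)
    hence "x = - 1" using 3 x0 by (auto simp: abs_if split: if_splits)
    hence "pi ^ 2 * (48 * real_of_int A - 24 * B - 1) = 0"
      using eq(1) Re_dilog_cis[of pi] by (simp add: x field_simps power2_eq_square)
    hence "48 * real_of_int A - 24 * B - 1 = 0" by simp
    hence "48 * A - 24 * B - 1 = 0" by linarith
    thus False by presburger
  qed
qed

text \<open>A positive imaginary part of the dilogarithm forces \<open>Re (Ln \<rho>) < 0\<close>.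
  Then \<open>Re (dilog \<rho>)\<close> is at most pi^2 / 6, and a positive argument yields 1 / 6 +
  4 A > 0.\<close>

lemma zero_upper:
  assumes "B > 0" "phi A B \<rho> = 0" "0 < Im \<rho>"
  shows "norm \<rho> < 1" "0 \<le> A"
proof -
  have \<rho>0: "\<rho> \<noteq> 0" using assms(3) by auto
  have eq: "Re (dilog \<rho>) + 4 * pi ^ 2 * A - 2 * pi * B * Im (Ln \<rho>) = 0"
    "Im (dilog \<rho>) + 2 * pi * B * Re (Ln \<rho>) = 0"
    using assms(2) unfolding phi_eq_0_iff by auto
  have "2 * pi * B * Re (Ln \<rho>) < 0" using eq(2) Im_dilog_pos[OF assms(3)] by linarith
  hence "Re (Ln \<rho>) < 0" using assms(1) by (simp add: mult_less_0_iff)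
  thus 1: "norm \<rho> < 1" using \<rho>0 by simp
  have "Re (dilog \<rho>) \<le> pi ^ 2 / 6"
    using norm_dilog_le[of \<rho>] 1 complex_Re_le_cmod[of "dilog \<rho>"] by linarith
  moreover have "0 < 2 * pi * B * Im (Ln \<rho>)"
    using assms(1,3) Im_Ln_pos_lt_imp by simp
  ultimately have "0 < pi ^ 2 * (1 / 6 + 4 * A)" using eq(1) by (simp add: algebra_simps)
  hence "0 < 1 / 6 + 4 * real_of_int A" by (simp add: zero_less_mult_iff)
  thus "0 \<le> A" by linarith
qed

lemma zero_lower:
  assumes "B > 0" "phi A B \<rho> = 0" "Im \<rho> < 0"
  shows "0 < Re (Ln \<rho>)" "Re (Ln \<rho>) * (2 * pi * B - pi) \<le> pi ^ 2 / 6" "A < 0"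
proof -
  define a b where "a = Re (Ln \<rho>)" and "b = Im (Ln \<rho>)"
  have \<rho>0: "\<rho> \<noteq> 0" using assms(3) by auto
  have B1: "1 \<le> real_of_int B" using assms(1) by simp
  have eq: "Re (dilog \<rho>) + 4 * pi ^ 2 * A - 2 * pi * B * b = 0"
    "Im (dilog \<rho>) + 2 * pi * B * a = 0"
    using assms(2) unfolding phi_eq_0_iff a_def b_def by auto
  have "2 * pi * B * a > 0" using eq(2) Im_dilog_neg[OF assms(3)] by linarith
  moreover have "0 < 2 * pi * B" using assms(1) by simp
  ultimately have a: "a > 0" by (rule zero_less_mult_pos)
  thus "0 < Re (Ln \<rho>)" by (simp add: a_def)
  hence "1 < norm \<rho>" using \<rho>0 by simp
  hence inv: "norm (dilog (1 / \<rho>)) \<le> pi ^ 2 / 6"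
    by (intro norm_dilog_le) (simp add: norm_divide divide_le_eq_1)
  have b: "b < 0" "- pi < b"
    using assms(3) \<rho>0 mpi_less_Im_Ln[of \<rho>] Im_Ln_pos_le[of \<rho>] Im_Ln_le_pi[of \<rho>]
    by (auto simp: b_def not_le[symmetric])
  have Ln: "Ln \<rho> + \<i> * of_real pi = Complex a (b + pi)"
    by (simp add: a_def b_def complex_eq_iff)
  have im: "Im (dilog \<rho>) = - Im (dilog (1 / \<rho>)) - a * (b + pi)"
    and re: "Re (dilog \<rho>) = - Re (dilog (1 / \<rho>)) - pi ^ 2 / 6 - (a ^ 2 - (b + pi) ^ 2) / 2"
    unfolding dilog_inversion[OF assms(3)] Ln by (simp_all add: power2_eq_square field_simps)
  have "a * (2 * pi * B - pi) = Im (dilog (1 / \<rho>)) + a * b"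
    using eq(2) im by (simp add: algebra_simps)
  also have "\<dots> \<le> pi ^ 2 / 6"
    using inv abs_Im_le_cmod[of "dilog (1 / \<rho>)"] mult_pos_neg[OF a b(1)] by linarith
  finally have ab: "a * (2 * pi * B - pi) \<le> pi ^ 2 / 6" .
  thus "Re (Ln \<rho>) * (2 * pi * B - pi) \<le> pi ^ 2 / 6" by (simp add: a_def)
  have "pi * 1 \<le> pi * B" using B1 by (intro mult_left_mono) auto
  hence piB: "pi \<le> 2 * pi * B - pi" by simp
  hence "a * pi \<le> a * (2 * pi * B - pi)" using a by (intro mult_left_mono) auto
  hence "a * pi \<le> pi ^ 2 / 6" using ab by linarith
  hence a2: "a \<le> pi / 6" by (simp add: power2_eq_square field_simps)
  \<comment> \<open>If \<open>A\<close> were nonnegative, the real equation would make a sum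
    nonpositive that is at least pi^2 / 6 - a^2 / 2, which is positive because a is at most pi /
    6.\<close>
  show "A < 0"
  proof (rule ccontr)
    assume "\<not> A < 0"
    hence "0 \<le> pi ^ 2 * A" by simp
    hence "0 \<ge> Re (dilog \<rho>) - 2 * pi * B * b" using eq(1) by linarith
    moreover have "Re (dilog (1 / \<rho>)) \<le> pi ^ 2 / 6"
      using inv complex_Re_le_cmod[of "dilog (1 / \<rho>)"] by linarith
    ultimately have "pi ^ 2 / 6 - a ^ 2 / 2 + b ^ 2 / 2 + (2 * pi * B - pi) * (- b) \<le> 0"
      using re by (simp add: power2_eq_square field_simps)
    moreover have "0 \<le> (2 * pi * B - pi) * (- b)"
      using piB b pi_gt_zero by (intro mult_nonneg_nonneg) linarith+
    moreover have "a ^ 2 \<le> (pi / 6) ^ 2" using a a2 by (intro power_mono) auto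
    moreover have "0 \<le> b ^ 2" "0 < pi ^ 2" by auto
    ultimately show False unfolding power2_eq_square by linarith
  qed
qed

subsection \<open>Initial values off the real axis\<close>

lemma newton_seq_0:
  assumes "A \<noteq> 0"
  shows "newton_seq A B 0 = cis (2 * pi * A / B)"
  using assms by (simp add: cis_conv_exp mult_ac)

text \<open>The minimum is at distance \<open>x = pi / b\<close> from a multiple of pi. Since x is
  at most pi / 3, the cubic bound gives \<open>sin x \<ge> 8 / 10 * x\<close>, and 8 pi / 10 exceeds
  2.\<close>

lemma abs_sin_ge:
  assumes b: "3 \<le> b" and \<theta>: "pi / b \<le> \<bar>\<theta>\<bar>" "\<bar>\<theta>\<bar> \<le> pi - pi / b"
  shows "2 / b \<le> \<bar>sin \<theta>\<bar>"
proof -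
  define x where "x = pi / b"
  have x: "0 < x" "x \<le> pi / 3" unfolding x_def using b by (auto simp: field_simps)
  have "x - x ^ 3 / 6 \<le> sin x" using x by (intro sin_ge_cubic) simp
  moreover have "x ^ 2 \<le> (pi / 3) ^ 2" using x by (intro power_mono) auto
  hence "x ^ 2 * x \<le> (pi / 3) ^ 2 * x" using x by (intro mult_right_mono) auto
  moreover have "pi ^ 2 * x \<le> 99 / 10 * x" using x pi_square_bounds by (intro mult_right_mono) auto
  moreover have "x ^ 3 = x ^ 2 * x" "(pi / 3) ^ 2 * x = pi ^ 2 * x / 9"
    by (simp_all add: power2_eq_square power3_eq_cube)
  ultimately have "8 / 10 * x \<le> sin x" using x by linarith
  moreover have "2 / b \<le> (8 / 10 * pi) / b"
    using b pi_bounds by (intro divide_right_mono) auto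
  hence "2 / b \<le> 8 / 10 * x" by (simp add: x_def)
  moreover have "sin x \<le> sin \<bar>\<theta>\<bar>"
  proof (cases "\<bar>\<theta>\<bar> \<le> pi / 2")
    case True
    thus ?thesis using x \<theta> by (intro sin_monotone_2pi_le) (auto simp: x_def)
  next
    case False
    have "sin x \<le> sin (pi - \<bar>\<theta>\<bar>)"
      using False x \<theta> by (intro sin_monotone_2pi_le) (auto simp: x_def)
    thus ?thesis by simp
  qed
  moreover have "sin \<bar>\<theta>\<bar> = \<bar>sin \<theta>\<bar>"
    using sin_ge_zero[of "\<bar>\<theta>\<bar>"] \<theta> x by (auto simp: abs_if x_def)
  ultimately show ?thesis by linarith
qed

lemma abs_ln_le:
  assumes "0 < l" "l \<le> y" "y \<le> u" "- ln l \<le> k" "ln u \<le> k"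
  shows "\<bar>ln y\<bar> \<le> (k::real)"
proof -
  have "ln l \<le> ln y" "ln y \<le> ln u" using assms by auto
  thus ?thesis using assms by linarith
qed

lemma norm_Ln_zero_eq:
  assumes "phi A B \<rho> = 0" "B > 0"
  shows "norm (Ln \<rho> - \<i> * of_real (2 * pi * A / B)) = norm (dilog \<rho>) / (2 * pi * B)"
  unfolding Ln_zero_eq[OF assms] using assms(2) by (simp add: norm_mult norm_divide)

lemma diff_cis_eq:
  assumes "\<rho> \<noteq> 0"
  shows "\<rho> - cis \<theta> = cis \<theta> * (exp (Ln \<rho> - \<i> * of_real \<theta>) - 1)"
  using assms by (simp add: cis_conv_exp exp_diff field_simps)

text \<open>The height of \<open>c\<close> is at least \<open>2 / b\<close>, so a disc of radius
  \<open>(8 / 10) / b\<close> stays \<open>(12 / 10) / b\<close> away from the real axis, hence from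
  1 and from both cuts. The initial error is at most \<open>(57 / 100) / b\<close>, and the ball
  holding the later iterates has radius at most \<open>(21 / 100) / b\<close>; together they fit
  into the disc. The last claim follows because the derivative of \<open>dilog\<close> on the disc
  is O(1 + ln b).\<close>

lemma off_axis_zero:
  fixes A B :: int
  assumes B: "3 \<le> B" and A: "A \<noteq> 0" "2 * \<bar>A\<bar> < B"
    and zero: "phi A B \<rho> = 0" "\<rho> \<noteq> 0" and dil: "norm (dilog \<rho>) \<le> 3"
  shows "newton_seq A B n \<noteq> 0 \<and> newton_seq A B n \<noteq> 1 \<and> dphi A B (newton_seq A B n) \<noteq> 0"
    and "converges_quadratically (newton_seq A B) \<rho>"
    and "norm (dilog \<rho> - dilog (cis (2 * pi * A / B))) \<le> 10 * (1 + ln B) / B"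
proof -
  define b where "b = real_of_int B"
  define \<theta> where "\<theta> = 2 * pi * A / B"
  define c where "c = cis \<theta>"
  define S where "S = cball c ((8 / 10) / b)"
  have b: "3 \<le> b" using B by (simp add: b_def)
  have "1 \<le> \<bar>real_of_int A\<bar>" using A by linarith
  hence "pi * 1 \<le> pi * \<bar>real_of_int A\<bar>" by (intro mult_left_mono) auto
  hence \<theta>1: "pi / b \<le> \<bar>\<theta>\<bar>"
    unfolding \<theta>_def b_def[symmetric] abs_divide abs_mult using b by (simp add: field_simps)
  have "2 * \<bar>real_of_int A\<bar> \<le> b - 1" unfolding b_def using A by linarith
  hence "pi * (2 * \<bar>real_of_int A\<bar>) \<le> pi * (b - 1)" by (intro mult_left_mono) auto
  hence \<theta>2: "\<bar>\<theta>\<bar> \<le> pi - pi / b"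
    unfolding \<theta>_def b_def[symmetric] abs_divide abs_mult using b by (simp add: field_simps)
  have Imc: "2 / b \<le> \<bar>Im c\<bar>" unfolding c_def using abs_sin_ge[OF b \<theta>1 \<theta>2] by simp
  have near: "\<bar>Im z - Im c\<bar> \<le> (8 / 10) / b" "\<bar>norm z - 1\<bar> \<le> (8 / 10) / b" if "z \<in> S" for z
  proof -
    have *: "norm (z - c) \<le> (8 / 10) / b" using that by (simp add: S_def dist_norm norm_minus_commute)
    show "\<bar>Im z - Im c\<bar> \<le> (8 / 10) / b" using * abs_Im_le_cmod[of "z - c"] by simp
    show "\<bar>norm z - 1\<bar> \<le> (8 / 10) / b" using * norm_triangle_ineq3[of z c] by (simp add: c_def)
  qed
  have b3: "(8 / 10) / b \<le> 4 / 15" using b by (simp add: field_simps)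
  have r: "11 / 15 \<le> norm z" and R: "norm z \<le> 19 / 15" if "z \<in> S" for z
    using near(2)[OF that] b3 by linarith+
  have Imz: "(12 / 10) / b \<le> \<bar>Im z\<bar>" if "z \<in> S" for z
  proof -
    have "2 / b - (8 / 10) / b = (12 / 10) / b" using b by (simp add: field_simps)
    thus ?thesis using near(1)[OF that] Imc by linarith
  qed
  have pos12: "0 < (12 / 10) / b" using b by simp
  have slit: "z \<notin> complex_of_real ` {1..}" if "z \<in> S" for z
    using Imz[OF that] pos12 by (intro not_in_slit) auto
  have c08: "(8 / 10) / b < 2 / b" using b by (intro divide_strict_right_mono) auto
  have side: "S \<subseteq> {z. 0 \<le> Im z} \<or> S \<subseteq> {z. Im z < 0}"
  proof (cases "0 \<le> Im c")
    case True
    have "0 \<le> Im z" if "z \<in> S" for z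
      using True near(1)[OF that] Imz[OF that] Imc c08 pos12 by linarith
    thus ?thesis by auto
  next
    case False
    have "Im z < 0" if "z \<in> S" for z
      using False near(1)[OF that] Imz[OF that] Imc c08 pos12 by linarith
    thus ?thesis by auto
  qed
  have d: "(12 / 10) / b \<le> norm (1 - z)" if "z \<in> S" for z
    using Imz[OF that] abs_Im_le_cmod[of "1 - z"] by simp
  \<comment> \<open>The linear bound makes the Newton constant independent of \<open>b\<close>; the
    logarithmic one gives the order of the final error.\<close>
  have nln: "\<bar>ln (norm (1 - z))\<bar> \<le> b / 3" "\<bar>ln (norm (1 - z))\<bar> \<le> 1 + ln b" if "z \<in> S" for z
  proof -
    have u: "norm (1 - z) \<le> 34 / 15"
      using R[OF that] norm_triangle_ineq4[of 1 z] by simp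
    have l: "- ln ((12 / 10) / b) = ln (b / (12 / 10))" using b by (simp add: ln_div)
    have "ln (34 / 15) \<le> 2 / 5 * (34 / 15 :: real)" by (rule ln_le_two_fifths) simp
    moreover have "ln (b / (12 / 10)) \<le> 2 / 5 * (b / (12 / 10))" using b by (intro ln_le_two_fifths) simp
    ultimately show "\<bar>ln (norm (1 - z))\<bar> \<le> b / 3"
      using b l by (intro abs_ln_le[OF pos12 d[OF that] u]) auto
    have "ln (b / (12 / 10)) \<le> ln b" using b by (subst ln_le_cancel_iff) (auto simp: field_simps)
    moreover have "0 \<le> ln b" using b by simp
    ultimately show "\<bar>ln (norm (1 - z))\<bar> \<le> 1 + ln b"
      using \<open>ln (34 / 15) \<le> _\<close> l by (intro abs_ln_le[OF pos12 d[OF that] u]) auto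
  qed
  have nLn: "norm (Ln (1 - z)) \<le> pi + b / 3" "norm (Ln (1 - z)) \<le> pi + (1 + ln b)" if "z \<in> S" for z
  proof -
    have "1 - z \<noteq> 0" using d[OF that] pos12 by auto
    from norm_Ln_le[OF this] abs_Im_Ln_le_pi[OF this] nln[OF that]
    show "norm (Ln (1 - z)) \<le> pi + b / 3" "norm (Ln (1 - z)) \<le> pi + (1 + ln b)" by linarith+
  qed
  \<comment> \<open>Since b is at least 3, the loss of pi in the lower half-plane is absorbed: 2 pi
    b - pi is at least 5 pi b / 3.\<close>
  have pib: "pi \<le> pi * b / 3" using b pi_gt_zero by (simp add: field_simps)
  have m: "5 * pi * b / 3 \<le> norm (- Ln (1 - z) + 2 * of_real pi * \<i> * of_int B)" if "z \<in> S" for z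
  proof -
    have "0 < pi * b" using b by simp
    thus ?thesis
      using norm_dphi_numerator_ge(1)[OF _ slit[OF that], of B] norm_dphi_numerator_ge(2)[of z B] pib
      unfolding b_def[symmetric] by (cases "0 \<le> Im z") linarith+
  qed
  define u where "u = Ln \<rho> - \<i> * of_real \<theta>"
  have "norm u = norm (dilog \<rho>) / (2 * pi * b)"
    using norm_Ln_zero_eq[OF zero(1)] B by (simp add: u_def \<theta>_def b_def)
  also have "\<dots> \<le> 3 / (2 * (31415 / 10000) * b)"
    using dil b pi_bounds by (intro frac_le mult_right_mono) auto
  also have "\<dots> \<le> (4776 / 10000) / b" using b by (simp add: field_simps)
  finally have u: "norm u \<le> (4776 / 10000) / b" .
  also have "\<dots> \<le> 16 / 100" using b by (simp add: field_simps)
  finally have u2: "norm u \<le> 16 / 100" .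
  have "exp (norm u) \<le> 1 + norm u + norm u ^ 2" using u2 by (intro exp_bound) auto
  also have "norm u ^ 2 \<le> (16 / 100) ^ 2" using u2 by (intro power_mono) auto
  finally have eu: "exp (norm u) \<le> 119 / 100" using u2 by (simp add: power2_eq_square)
  have "norm (\<rho> - c) = norm (exp u - 1)"
    unfolding c_def diff_cis_eq[OF zero(2)] u_def by (simp add: norm_mult)
  also have "\<dots> \<le> exp (norm u) * norm u" by (rule norm_exp_minus_one_le)
  also have "\<dots> \<le> 119 / 100 * ((4776 / 10000) / b)" using u eu b by (intro mult_mono) auto
  also have "\<dots> \<le> (57 / 100) / b" using b by (simp add: field_simps)
  finally have e: "norm (\<rho> - c) \<le> (57 / 100) / b" .
  have "(57 / 100) / b \<le> (8 / 10) / b" using b by (intro divide_right_mono) auto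
  hence \<rho>S: "\<rho> \<in> S" using e by (simp add: S_def dist_norm norm_minus_commute)
  have cS: "c \<in> S" using b by (simp add: S_def)
  have e1: "norm (c - \<rho>) \<le> 19 / 100"
  proof -
    have "(57 / 100) / b \<le> 19 / 100" using b by (simp add: field_simps)
    thus ?thesis using e by (simp add: norm_minus_commute)
  qed
  have e2: "19 / 10 * norm (c - \<rho>) ^ 2 \<le> (21 / 100) / b"
  proof -
    have "norm (c - \<rho>) ^ 2 \<le> ((57 / 100) / b) * (19 / 100)"
      unfolding power2_eq_square using e e1 b by (intro mult_mono) (auto simp: norm_minus_commute)
    thus ?thesis using b by (simp add: field_simps)
  qed
  \<comment> \<open>Every bound entering here is linear in \<open>b\<close>, so \<open>b\<close>
    cancels and one constant serves for all \<open>B\<close>.\<close>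
  have K: "(19 / 15) / (2 * (5 * pi * b / 3)) * ((1 / ((12 / 10) / b) + (2 * pi * B + (pi * b / 3 + b / 3)) / (11 / 15)) / (11 / 15)) \<le> 19 / 10"
    unfolding b_def[symmetric] using b pi_bounds by (simp add: field_simps)
  have ball: "cball \<rho> (19 / 10 * norm (c - \<rho>) ^ 2) \<subseteq> S"
  proof
    fix z assume "z \<in> cball \<rho> (19 / 10 * norm (c - \<rho>) ^ 2)"
    hence "norm (z - \<rho>) \<le> (21 / 100) / b" using e2 by (simp add: dist_norm norm_minus_commute)
    hence "norm (z - c) \<le> (21 / 100) / b + (57 / 100) / b"
      using e norm_triangle_ineq[of "z - \<rho>" "\<rho> - c"] by simp
    also have "\<dots> \<le> (8 / 10) / b" using b by (simp add: field_simps)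
    finally show "z \<in> S" by (simp add: S_def dist_norm norm_minus_commute)
  qed
  have c: "newton_seq A B 0 = c" using newton_seq_0[OF A(1)] by (simp add: c_def \<theta>_def)
  have L: "norm (Ln (1 - z)) \<le> pi * b / 3 + b / 3" if "z \<in> S" for z
    using nLn(1)[OF that] pib by linarith
  have cvx: "convex S" by (simp add: S_def)
  have Bpos: "0 < B" and mpos: "0 < 5 * pi * b / 3" using B b by auto
  note main = newton_seq_converges[OF Bpos cvx side slit pos12 d _ r R L mpos m K \<rho>S zero(1), unfolded c, OF _ _ _ _ _ _ _ cS _ ball]
  show "newton_seq A B n \<noteq> 0 \<and> newton_seq A B n \<noteq> 1 \<and> dphi A B (newton_seq A B n) \<noteq> 0"
    by (rule main(1)) (use e1 in auto)
  show "converges_quadratically (newton_seq A B) \<rho>"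
    by (rule main(2)) (use e1 in auto)
  have "norm (dilog \<rho> - dilog c) \<le> (pi + (1 + ln b)) / (11 / 15) * norm (\<rho> - c)"
  proof (rule field_differentiable_bound[OF cvx _ _ \<rho>S cS])
    fix z assume z: "z \<in> S"
    have "z \<noteq> 0" using r[OF z] by auto
    thus "(dilog has_field_derivative - Ln (1 - z) / z) (at z within S)"
      by (intro has_field_derivative_at_within[OF has_field_derivative_dilog] slit z)
    have "0 \<le> ln b" using b by simp
    thus "norm (- Ln (1 - z) / z) \<le> (pi + (1 + ln b)) / (11 / 15)"
      unfolding norm_divide using nLn(2)[OF z] r[OF z] by (intro frac_le) auto
  qed
  also have "\<dots> \<le> (pi + (1 + ln b)) / (11 / 15) * ((57 / 100) / b)"
    using e b by (intro mult_left_mono divide_nonneg_pos add_nonneg_nonneg) auto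
  also have "\<dots> \<le> 10 * (1 + ln b) / b"
  proof -
    have "0 \<le> ln b" using b by simp
    hence "(pi + (1 + ln b)) / (11 / 15) * (57 / 100) \<le> 10 * (1 + ln b)"
      using pi_bounds by (simp add: field_simps)
    hence "(pi + (1 + ln b)) / (11 / 15) * (57 / 100) / b \<le> 10 * (1 + ln b) / b"
      using b by (intro divide_right_mono) auto
    thus ?thesis by simp
  qed
  finally show "norm (dilog \<rho> - dilog (cis (2 * pi * A / B))) \<le> 10 * (1 + ln B) / B"
    by (simp add: b_def c_def \<theta>_def)
qed

lemma upper_dilog_bound:
  assumes "norm \<rho> < 1"
  shows "norm (dilog \<rho>) \<le> 3"
  using norm_dilog_le[OF less_imp_le[OF assms]] pi_square_bounds by simp

text \<open>The path leads radially from the unit circle, where the series bound holds, out to the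
  zero. Its logarithmic length \<open>a\<close> is at most pi / 30 because B is at least 3, and the
  dilogarithm changes by at most 1 along it.\<close>

lemma lower_dilog_bound:
  assumes B: "3 \<le> B" and zero: "phi A B \<rho> = 0" "Im \<rho> < 0"
  shows "norm (dilog \<rho>) \<le> 3"
proof -
  define a b where "a = Re (Ln \<rho>)" and "b = Im (Ln \<rho>)"
  have \<rho>0: "\<rho> \<noteq> 0" using zero by auto
  have B0: "0 < B" using B by simp
  have a: "0 < a" "a * (2 * pi * B - pi) \<le> pi ^ 2 / 6"
    using zero_lower(1,2)[OF B0 zero] by (auto simp: a_def)
  have "pi * 3 \<le> pi * B" using B by (intro mult_left_mono) auto
  hence "a * (5 * pi) \<le> a * (2 * pi * B - pi)" using a by (intro mult_left_mono) auto
  hence "a * (5 * pi) \<le> pi ^ 2 / 6" using a by linarith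
  hence "a \<le> pi / 30" by (simp add: power2_eq_square field_simps)
  hence a1: "a \<le> 105 / 1000" using pi_bounds by simp
  have b: "b < 0" "- pi < b"
    using zero(2) \<rho>0 mpi_less_Im_Ln[of \<rho>] Im_Ln_pos_le[of \<rho>] Im_Ln_le_pi[of \<rho>]
    by (auto simp: b_def not_le[symmetric])
  define E where "E = (\<lambda>s. exp (Complex s b))"
  have Im_E: "Im (E s) < 0" for s
  proof -
    have "sin b < 0" using sin_gt_zero[of "- b"] b by simp
    thus ?thesis by (simp add: E_def Im_exp mult_pos_neg)
  qed
  have E_nz: "E s \<noteq> 0" for s by (simp add: E_def)
  have norm_E: "norm (E s) = exp s" for s by (simp add: E_def)
  have E_der: "(E has_vector_derivative E s) (at s)" for s
  proof -
    have "((\<lambda>s. Complex s b) has_vector_derivative 1) (at s)"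
    proof -
      have "(\<lambda>s. Complex s b) = (\<lambda>s. of_real s + \<i> * of_real b)"
        by (simp add: fun_eq_iff complex_eq_iff)
      thus ?thesis by (auto intro!: derivative_eq_intros)
    qed
    from field_vector_diff_chain_at[OF this DERIV_exp] show ?thesis
      by (simp add: E_def o_def)
  qed
  have der: "((\<lambda>s. dilog (E s)) has_vector_derivative - Ln (1 - E s)) (at s)" for s
  proof -
    have "Im (E s) \<noteq> 0" using Im_E[of s] by simp
    hence "(dilog has_field_derivative - Ln (1 - E s) / E s) (at (E s))"
      using E_nz by (intro has_field_derivative_dilog not_in_slit) auto
    from field_vector_diff_chain_at[OF E_der this] show ?thesis
      using E_nz[of s] by (simp add: o_def)
  qed
  \<comment> \<open>The distance of \<open>E s\<close> from 1 is at least
    \<open>exp s - 1 \<ge> s\<close>, even when the ray passes close to 1, so the derivative has at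
    worst an integrable logarithmic singularity.\<close>
  have "norm (dilog (E a) - dilog (E 0)) \<le> a * ((pi + 12 / 10) + 1 - ln a)"
  proof (rule norm_diff_le_of_log_bound[OF a(1)])
    show "continuous_on {0..a} (\<lambda>s. dilog (E s))"
      by (rule continuous_on_vector_derivative) (rule has_vector_derivative_at_within[OF der])
    show "((\<lambda>s. dilog (E s)) has_vector_derivative - Ln (1 - E s)) (at s)" for s
      by (rule der)
    fix s assume s: "0 < s" "s < a"
    have nz: "1 - E s \<noteq> 0" using Im_E[of s] by (metis eq_iff_diff_eq_0 one_complex.sel(2) less_irrefl)
    have "s \<le> exp s - 1" using exp_ge_add_one_self[of s] by linarith
    also have "\<dots> \<le> norm (1 - E s)"
      using norm_triangle_ineq2[of "E s" 1] by (simp add: norm_E norm_minus_commute)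
    finally have l: "s \<le> norm (1 - E s)" .
    have "norm (1 - E s) \<le> 1 + exp s"
      using norm_triangle_ineq4[of 1 "E s"] by (simp add: norm_E)
    also have "exp s \<le> 1 + s + s ^ 2" using s a1 by (intro exp_bound) auto
    also have "s ^ 2 \<le> s * (105 / 1000)" unfolding power2_eq_square using s a1 by (intro mult_left_mono) auto
    finally have u: "norm (1 - E s) \<le> 22 / 10" using s a1 by simp
    have "ln (norm (1 - E s)) \<le> norm (1 - E s) - 1" using nz by (intro ln_le_minus_one) simp
    moreover have "ln s \<le> ln (norm (1 - E s))" using l s nz by (subst ln_le_cancel_iff) auto
    moreover have "ln s \<le> 0" using s a1 by simp
    ultimately have "\<bar>ln (norm (1 - E s))\<bar> \<le> 12 / 10 - ln s" using u by linarith
    thus "norm (- Ln (1 - E s)) \<le> pi + 12 / 10 - ln s"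
      using norm_Ln_le[OF nz] abs_Im_Ln_le_pi[OF nz] by simp
  qed
  moreover have "Complex a b = Ln \<rho>" by (simp only: a_def b_def complex_surj)
  hence "E a = \<rho>" using \<rho>0 by (simp add: E_def)
  moreover have "norm (dilog (E 0)) \<le> pi ^ 2 / 6" by (rule norm_dilog_le) (simp add: norm_E)
  moreover have "a * ((pi + 12 / 10) + 1 - ln a) \<le> 1"
  proof -
    have "ln (1 / a) \<le> 2 / 5 * (1 / a)" using a by (intro ln_le_two_fifths) simp
    hence "a * (- ln a) \<le> a * (2 / 5 * (1 / a))"
      using a by (intro mult_left_mono) (auto simp: ln_div)
    hence "a * (- ln a) \<le> 4 / 10" using a by simp
    moreover have "a * (pi + 22 / 10) \<le> 105 / 1000 * (53416 / 10000)" using a a1 pi_bounds by (intro mult_mono) auto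
    ultimately show ?thesis by (simp add: algebra_simps)
  qed
  moreover have "norm (dilog \<rho>) \<le> norm (dilog \<rho> - dilog (E 0)) + norm (dilog (E 0))"
    using norm_triangle_ineq[of "dilog \<rho> - dilog (E 0)" "dilog (E 0)"] by simp
  ultimately show ?thesis using pi_square_bounds by simp
qed

subsection \<open>The initial value -1\<close>

text \<open>The initial value -1 lies on the cut of \<open>Ln\<close>, so the region is a half-disc
  with -1 on its boundary. The zero has height at least \<open>(9 / 100) / b\<close>, more than the
  radius \<open>(12 / 1000) / b\<close> that contains all later iterates; they never cross the
  cut.\<close>

lemma zero_near_minus_one:
  fixes A B :: int
  assumes A: "0 < A" "B = 2 * A" and zero: "phi A B \<rho> = 0" "0 < Im \<rho>"
  shows "newton_seq A B n \<noteq> 0 \<and> newton_seq A B n \<noteq> 1 \<and> dphi A B (newton_seq A B n) \<noteq> 0"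
    and "converges_quadratically (newton_seq A B) \<rho>"
    and "norm (dilog \<rho> - dilog (cis (2 * pi * A / B))) \<le> 10 * (1 + ln B) / B"
proof -
  define b where "b = real_of_int B"
  define S where "S = cball (-1) ((3 / 10) / b) \<inter> {z. 0 \<le> Im z}"
  have b: "2 \<le> b" using A by (simp add: b_def)
  have \<rho>0: "\<rho> \<noteq> 0" using zero by auto
  have B: "0 < B" using A by simp
  have \<theta>: "2 * pi * A / B = pi" using A by simp
  have \<rho>1: "norm \<rho> < 1" by (rule zero_upper(1)[OF B zero])
  define u where "u = Ln \<rho> - \<i> * of_real pi"
  have u: "u = \<i> * dilog \<rho> / of_real (2 * pi * b)"
    using Ln_zero_eq[OF zero(1) B] unfolding \<theta> by (simp add: u_def b_def)
  have nu: "norm u = norm (dilog \<rho>) / (2 * pi * b)"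
    unfolding u using b by (simp add: norm_mult norm_divide)
  have "Re u < 0" using \<rho>1 \<rho>0 by (simp add: u_def)
  have "\<rho> - (-1) = - (exp u - 1)"
    using diff_cis_eq[OF \<rho>0, of pi] by (simp add: u_def)
  hence \<rho>u: "\<rho> + 1 = - (exp u - 1)" by simp
  have e_u: "norm (\<rho> + 1) \<le> norm u"
    unfolding \<rho>u norm_minus_cancel using norm_exp_diff_le[of u 0] \<open>Re u < 0\<close> by simp
  have "norm u \<le> (pi ^ 2 / 6) / (2 * pi * b)"
    unfolding nu using norm_dilog_le[of \<rho>] \<rho>1 b by (intro divide_right_mono) auto
  also have "\<dots> = pi / (12 * b)" by (simp add: power2_eq_square)
  also have "\<dots> \<le> (262 / 1000) / b" using pi_bounds b by (simp add: field_simps)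
  finally have u1: "norm u \<le> (262 / 1000) / b" .
  also have "\<dots> \<le> 131 / 1000" using b by (simp add: field_simps)
  finally have u2: "norm u \<le> 131 / 1000" .
  have H: "convex {z. Re z \<le> - 1 / 2}" by (rule convex_halfspace_Re_le)
  \<comment> \<open>Bootstrap: the crude bound pi^2 / 6 already places the zero near -1. There
    \<open>dilog\<close> is 1-Lipschitz and close to - pi^2 / 12, which sharpens the estimate of
    \<open>u\<close>.\<close>
  have "norm (dilog \<rho> - dilog (-1)) \<le> 1 * norm (\<rho> - (-1))"
  proof (rule field_differentiable_bound[OF H])
    fix z :: complex assume "z \<in> {z. Re z \<le> - 1 / 2}"
    hence z: "Re z \<le> - 1 / 2" "z \<noteq> 0" "Re z < 1" by auto
    thus "(dilog has_field_derivative - Ln (1 - z) / z) (at z within {z. Re z \<le> - 1 / 2})"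
      by (intro has_field_derivative_at_within[OF has_field_derivative_dilog] not_in_slit)
    show "norm (- Ln (1 - z) / z) \<le> 1"
      using norm_Ln_one_minus_le[of z] z by (simp add: norm_divide divide_le_eq_1)
  next
    have "Re \<rho> + 1 \<le> norm (\<rho> + 1)" using complex_Re_le_cmod[of "\<rho> + 1"] by simp
    thus "\<rho> \<in> {z. Re z \<le> - 1 / 2}" using e_u u2 by simp
  qed simp
  hence dd: "norm (dilog \<rho> - dilog (-1)) \<le> norm u" using e_u by simp
  have dm1: "dilog (-1) = - of_real (pi ^ 2 / 12)"
    using Re_dilog_cis[of pi] Im_dilog_real[of "-1"] by (simp add: complex_eq_iff)
  have dm1_norm: "norm (dilog (-1)) = pi ^ 2 / 12"
    unfolding dm1 norm_minus_cancel norm_of_real by simp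
  have "norm (dilog \<rho>) \<le> 96 / 100"
    using norm_triangle_ineq[of "dilog \<rho> - dilog (-1)" "dilog (-1)"] dd u2 dm1_norm pi_square_bounds
    by simp
  hence "norm u \<le> (96 / 100) / (2 * (31415 / 10000) * b)"
    unfolding nu using b pi_bounds by (intro frac_le mult_right_mono) auto
  also have "\<dots> \<le> (153 / 1000) / b" using b by (simp add: field_simps)
  finally have u3: "norm u \<le> (153 / 1000) / b" .
  have u4: "norm u ^ 2 \<le> (12 / 1000) / b"
  proof -
    have "(153 / 1000) / b \<le> 765 / 10000" using b by (simp add: field_simps)
    hence "norm u ^ 2 \<le> ((153 / 1000) / b) * (765 / 10000)"
      unfolding power2_eq_square using u3 b by (intro mult_mono) auto
    also have "\<dots> \<le> (12 / 1000) / b" using b by (simp add: field_simps)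
    finally show ?thesis .
  qed
  \<comment> \<open>To first order \<open>\<rho> + 1\<close> is \<open>- u\<close>, and
    \<open>Im u\<close> is about - pi / (24 b) because \<open>dilog (-1)\<close> is - pi^2 / 12. The
    quadratic remainder is small enough to keep the sign.\<close>
  have Im\<rho>: "(9 / 100) / b \<le> Im \<rho>"
  proof -
    have "Re (dilog \<rho>) + pi ^ 2 / 12 \<le> 131 / 1000"
      using complex_Re_le_cmod[of "dilog \<rho> - dilog (-1)"] dd u2 by (simp add: dm1)
    hence R: "Re (dilog \<rho>) \<le> - (69 / 100)" using pi_square_bounds by simp
    have "Im u = Re (dilog \<rho>) / (2 * pi * b)"
      unfolding u using b by (simp add: Im_divide power2_eq_square)
    also have "\<dots> \<le> - (69 / 100) / (2 * pi * b)" using R b by (intro divide_right_mono) auto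
    also have "\<dots> \<le> - (102 / 1000) / b" using b pi_bounds by (simp add: field_simps)
    finally have "Im u \<le> - (102 / 1000) / b" .
    moreover have "\<bar>Im (exp u - 1 - u)\<bar> \<le> (12 / 1000) / b"
      using abs_Im_le_cmod[of "exp u - 1 - u"] norm_exp_minus_linear_le[of u] \<open>Re u < 0\<close> u4
      by linarith
    moreover have "Im \<rho> = - Im (exp u - 1 - u) - Im u"
      using arg_cong[OF \<rho>u, of Im] by simp
    moreover have "(102 / 1000) / b = (9 / 100) / b + (12 / 1000) / b" using b by (simp add: field_simps)
    ultimately show ?thesis by linarith
  qed
  have near: "norm (z + 1) \<le> (3 / 10) / b" "0 \<le> Im z" "norm (z + 1) \<le> 15 / 100" if "z \<in> S" for z
  proof -
    show *: "norm (z + 1) \<le> (3 / 10) / b" "0 \<le> Im z"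
      using that by (auto simp: S_def dist_norm norm_minus_commute)
    have "(3 / 10) / b \<le> 15 / 100" using b by (simp add: field_simps)
    thus "norm (z + 1) \<le> 15 / 100" using * by linarith
  qed
  have Re: "Re z \<le> - (85 / 100)" if "z \<in> S" for z
    using near(3)[OF that] complex_Re_le_cmod[of "z + 1"] by simp
  have r: "85 / 100 \<le> norm z" and R: "norm z \<le> 115 / 100" if "z \<in> S" for z
    using near(3)[OF that] norm_triangle_ineq2[of z "-1"] norm_triangle_ineq2[of "-1" z]
    by (simp_all add: norm_minus_commute)
  have d: "1 \<le> norm (1 - z)" if "z \<in> S" for z
    using Re[OF that] complex_Re_le_cmod[of "1 - z"] by simp
  have slit: "z \<notin> complex_of_real ` {1..}" if "z \<in> S" for z
    using Re[OF that] by (intro not_in_slit) simp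
  have L: "norm (Ln (1 - z)) \<le> 115 / 100" if "z \<in> S" for z
    using norm_Ln_one_minus_le[of z] Re[OF that] R[OF that] by simp
  have m: "2 * pi * B \<le> norm (- Ln (1 - z) + 2 * of_real pi * \<i> * of_int B)" if "z \<in> S" for z
    by (rule norm_dphi_numerator_ge(1)[OF near(2)[OF that] slit[OF that]])
  have c0: "newton_seq A B 0 = -1" using newton_seq_0[of A B] A \<theta> by simp
  have e: "norm (-1 - \<rho>) = norm (\<rho> + 1)"
  proof -
    have "- 1 - \<rho> = - (\<rho> + 1)" by simp
    thus ?thesis by (simp only: norm_minus_cancel)
  qed
  have e2: "1 * norm (-1 - \<rho>) ^ 2 \<le> (12 / 1000) / b"
  proof -
    have "norm (\<rho> + 1) ^ 2 \<le> norm u ^ 2" using e_u by (intro power_mono) auto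
    thus ?thesis unfolding e using u4 by linarith
  qed
  have e1: "1 * norm (-1 - \<rho>) < 1" unfolding e using e_u u2 by simp
  have sums: "(12 / 1000) / b \<le> (9 / 100) / b" "(153 / 1000) / b + (12 / 1000) / b \<le> (3 / 10) / b" "(153 / 1000) / b \<le> (3 / 10) / b" "0 \<le> (3 / 10) / b"
    using b by (auto simp: field_simps)
  have "norm (\<rho> + 1) \<le> (3 / 10) / b" using e_u u3 sums by linarith
  hence \<rho>S: "\<rho> \<in> S" using zero(2) by (simp add: S_def dist_norm e)
  have cS: "-1 \<in> S" using sums by (simp add: S_def)
  have ball: "cball \<rho> (1 * norm (-1 - \<rho>) ^ 2) \<subseteq> S"
  proof
    fix z assume "z \<in> cball \<rho> (1 * norm (-1 - \<rho>) ^ 2)"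
    hence z: "norm (z - \<rho>) \<le> (12 / 1000) / b" using e2 by (simp add: dist_norm norm_minus_commute)
    have "norm (z + 1) \<le> (3 / 10) / b"
      using norm_triangle_ineq[of "z - \<rho>" "\<rho> + 1"] z e_u u3 sums by simp
    moreover have "- 1 - z = - (z + 1)" by simp
    hence "norm (- 1 - z) = norm (z + 1)" by (simp only: norm_minus_cancel)
    moreover have "0 \<le> Im z"
      using z abs_Im_le_cmod[of "z - \<rho>"] Im\<rho> sums by simp
    ultimately show "z \<in> S" by (simp add: S_def dist_norm)
  qed
  have cvx: "convex S" unfolding S_def by (intro convex_Int convex_cball convex_halfspace_Im_ge)
  have side: "S \<subseteq> {z. 0 \<le> Im z} \<or> S \<subseteq> {z. Im z < 0}" by (auto simp: S_def)
  have mpos: "0 < 2 * pi * B" using B by simp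
  have K: "(115 / 100) / (2 * (2 * pi * B)) * ((1 / 1 + (2 * pi * B + 115 / 100) / (85 / 100)) / (85 / 100)) \<le> 1"
  proof -
    have "2 * pi * b \<ge> 2 * (31415 / 10000) * 2" using b pi_bounds by (intro mult_mono) auto
    thus ?thesis unfolding b_def[symmetric] using b by (simp add: field_simps)
  qed
  note main = newton_seq_converges[OF B cvx side slit zero_less_one d _ r R L mpos m K \<rho>S zero(1), unfolded c0, OF _ _ _ _ _ _ _ cS e1 ball]
  show "newton_seq A B n \<noteq> 0 \<and> newton_seq A B n \<noteq> 1 \<and> dphi A B (newton_seq A B n) \<noteq> 0"
    by (rule main(1)) auto
  show "converges_quadratically (newton_seq A B) \<rho>"
    by (rule main(2)) auto
  have "norm (dilog \<rho> - dilog (cis (2 * pi * A / B))) \<le> (262 / 1000) / b"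
    unfolding \<theta> using dd u1 by simp
  also have "\<dots> \<le> 10 * (1 + ln b) / b"
  proof -
    have "0 \<le> ln b" using b by simp
    thus ?thesis using b by (intro divide_right_mono) auto
  qed
  finally show "norm (dilog \<rho> - dilog (cis (2 * pi * A / B))) \<le> 10 * (1 + ln B) / B"
    by (simp add: b_def)
qed

subsection \<open>The case A = 0\<close>

text \<open>The factor is 1 - 262 / 1000, left over after subtracting the quadratic remainder; 262 /
  1000 is just above pi / 12, the largest possible \<open>norm w\<close> for
  \<open>A = 0\<close>.\<close>

lemma norm_one_minus_exp_ge:
  assumes "Re z \<le> 0" "norm z \<le> 262 / 1000"
  shows "369 / 500 * norm z \<le> norm (1 - exp z)"
proof -
  have "norm z ^ 2 \<le> 262 / 1000 * norm z"
    unfolding power2_eq_square using assms by (intro mult_right_mono) auto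
  moreover have "norm z \<le> norm (1 - exp z) + norm (exp z - 1 - z)"
    using norm_triangle_ineq4[of "exp z - 1" "exp z - 1 - z"] by (simp add: norm_minus_commute)
  ultimately show ?thesis using norm_exp_minus_linear_le[OF assms(1)] by linarith
qed

text \<open>The difference quotient is the mean value of -log(1 - exp(t w)) over 0 < t < 1, and on the
  second quadrant the real part of the integrand is positive and at most O(1 - log |t w|) and its
  imaginary part lies between 0 and pi/2.\<close>

lemma dilog_quotient:
  fixes w :: complex
  assumes w: "Re w < 0" "0 < Im w" "norm w \<le> 262 / 1000"
  defines "D \<equiv> (dilog (exp w) - dilog 1) / w"
  shows "0 \<le> Re D" "Re D \<le> 1356 / 1000 - ln (norm w)" "0 \<le> Im D" "Im D \<le> pi / 2"
proof -
  define G where "G = (\<lambda>t. dilog (exp (of_real t * w)) / w)"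
  have w0: "w \<noteq> 0" using w by auto
  have cont: "continuous_on {0..1} G"
    unfolding G_def
  proof (intro continuous_intros w0)
    show "continuous_on {0..1} (\<lambda>t. dilog (exp (of_real t * w)))"
      by (rule continuous_on_compose2[OF continuous_on_dilog_cball])
         (use w in \<open>auto intro!: continuous_intros simp: mult_nonneg_nonpos\<close>)
  qed (use w0 in auto)
  have pt: "Re (of_real t * w) < 0" "0 < Im (of_real t * w)" "norm (of_real t * w) \<le> 262 / 1000"
      "norm (of_real t * w) = t * norm w" if "0 < t" "t < 1" for t
  proof -
    show *: "norm (of_real t * w) = t * norm w" using that by (simp add: norm_mult)
    have "t * norm w \<le> 1 * norm w" using that by (intro mult_right_mono) auto
    thus "norm (of_real t * w) \<le> 262 / 1000" using w(3) * by linarith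
  qed (use that w in \<open>auto simp: mult_pos_neg\<close>)
  have E: "norm (exp (of_real t * w)) < 1" "0 < Im (exp (of_real t * w))" if "0 < t" "t < 1" for t
  proof -
    show "norm (exp (of_real t * w)) < 1" using pt(1)[OF that] by simp
    have "Im (of_real t * w) \<le> 262 / 1000"
      using pt(3)[OF that] abs_Im_le_cmod[of "of_real t * w"] by linarith
    hence "0 < sin (Im (of_real t * w))"
      using pt(2)[OF that] pi_bounds by (intro sin_gt_zero) linarith+
    thus "0 < Im (exp (of_real t * w))" by (simp add: Im_exp)
  qed
  have der: "(G has_vector_derivative - Ln (1 - exp (of_real t * w))) (at t)" if "0 < t" "t < 1" for t
  proof -
    have "((\<lambda>t. exp (of_real t * w)) has_vector_derivative w * exp (of_real t * w)) (at t)"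
    proof -
      have "((\<lambda>t. of_real t * w) has_vector_derivative w) (at t)"
        by (auto intro!: derivative_eq_intros)
      from field_vector_diff_chain_at[OF this DERIV_exp] show ?thesis by (simp add: o_def)
    qed
    moreover have "(dilog has_field_derivative - Ln (1 - exp (of_real t * w)) / exp (of_real t * w))
        (at (exp (of_real t * w)))"
      using E(2)[OF that] by (intro has_field_derivative_dilog not_in_slit) auto
    ultimately have "((\<lambda>t. dilog (exp (of_real t * w))) has_vector_derivative
        (w * exp (of_real t * w)) * (- Ln (1 - exp (of_real t * w)) / exp (of_real t * w))) (at t)"
      by (rule field_vector_diff_chain_at[unfolded o_def])
    from has_vector_derivative_divide[OF this, of w] show ?thesis
      unfolding G_def using w0 by simp
  qed
  have nz: "1 - exp (of_real t * w) \<noteq> 0" if "0 < t" "t < 1" for t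
  proof
    assume "1 - exp (of_real t * w) = 0"
    hence eq: "exp (of_real t * w) = 1" by simp
    show False using E(2)[OF that] unfolding eq by simp
  qed
  have re: "0 \<le> - ln (norm (1 - exp (of_real t * w)))"
      "- ln (norm (1 - exp (of_real t * w))) \<le> (356 / 1000 - ln (norm w)) - ln t"
    if t: "0 < t" "t < 1" for t
  proof -
    have "norm (exp 0 - exp (of_real t * w)) \<le> norm (0 - of_real t * w)"
      using pt(1)[OF t] by (intro norm_exp_diff_le) auto
    hence "norm (1 - exp (of_real t * w)) \<le> 1" using pt(3)[OF t] by simp
    thus "0 \<le> - ln (norm (1 - exp (of_real t * w)))" using nz[OF t] by simp
    have "369 / 500 * (t * norm w) \<le> norm (1 - exp (of_real t * w))"
      using norm_one_minus_exp_ge[of "of_real t * w"] pt[OF t] by simp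
    hence "ln (369 / 500 * (t * norm w)) \<le> ln (norm (1 - exp (of_real t * w)))"
      using t w0 nz[OF t] by (subst ln_le_cancel_iff) auto
    moreover have "ln (369 / 500 * (t * norm w)) = ln (369 / 500) + (ln t + ln (norm w))"
      using t w0 by (subst ln_mult_pos, simp, simp, subst ln_mult_pos) auto
    \<comment> \<open>This is the source of 356 / 1000, which exceeds 131 / 369.\<close>
    moreover have "ln (500 / 369) \<le> 500 / 369 - (1::real)" by (rule ln_le_minus_one) simp
    moreover have "ln (500 / 369) = ln 500 - ln (369 :: real)" "ln (369 / 500) = ln 369 - ln (500 :: real)"
      by (simp_all add: ln_div)
    ultimately show "- ln (norm (1 - exp (of_real t * w))) \<le> (356 / 1000 - ln (norm w)) - ln t"
      by linarith
  qed
  have im: "0 \<le> - Im (Ln (1 - exp (of_real t * w)))" "- Im (Ln (1 - exp (of_real t * w))) \<le> pi / 2"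
    if t: "0 < t" "t < 1" for t
  proof -
    show "0 \<le> - Im (Ln (1 - exp (of_real t * w)))"
      using Im_Ln_one_minus(1)[of "exp (of_real t * w)"] E(2)[OF t] not_in_slit(1)[of "exp (of_real t * w)"]
      by simp
    have "Re (exp (of_real t * w)) < 1"
      using E(1)[OF t] complex_Re_le_cmod[of "exp (of_real t * w)"] by linarith
    hence "\<bar>Im (Ln (1 - exp (of_real t * w)))\<bar> < pi / 2"
      by (intro Re_Ln_pos_lt_imp) simp
    thus "- Im (Ln (1 - exp (of_real t * w))) \<le> pi / 2" by linarith
  qed
  have D: "G 1 - G 0 = D" by (simp add: G_def D_def diff_divide_distrib)
  have derR: "((\<lambda>t. Re (G t)) has_real_derivative - ln (norm (1 - exp (of_real t * w)))) (at t)"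
    if t: "0 < t" "t < 1" for t
    using bounded_linear.has_vector_derivative[OF bounded_linear_Re der[OF t]] nz[OF t]
    by (simp add: has_real_derivative_iff_has_vector_derivative)
  have derI: "((\<lambda>t. Im (G t)) has_real_derivative - Im (Ln (1 - exp (of_real t * w)))) (at t)"
    if t: "0 < t" "t < 1" for t
    using bounded_linear.has_vector_derivative[OF bounded_linear_Im der[OF t]]
    by (simp add: has_real_derivative_iff_has_vector_derivative)
  have contR: "continuous_on {0..1} (\<lambda>t. Re (G t))" and contI: "continuous_on {0..1} (\<lambda>t. Im (G t))"
    by (intro continuous_intros cont)+
  have "Re (G 0) \<le> Re (G 1)"
  proof (rule DERIV_nonneg_imp_increasing_open[OF zero_le_one _ contR])
    show "\<exists>y. ((\<lambda>t. Re (G t)) has_real_derivative y) (at t) \<and> 0 \<le> y" if t: "0 < t" "t < 1" for t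
      using derR[OF t] re(1)[OF t] by blast
  qed
  thus "0 \<le> Re D" by (simp flip: D)
  have "Im (G 0) \<le> Im (G 1)"
  proof (rule DERIV_nonneg_imp_increasing_open[OF zero_le_one _ contI])
    show "\<exists>y. ((\<lambda>t. Im (G t)) has_real_derivative y) (at t) \<and> 0 \<le> y" if t: "0 < t" "t < 1" for t
      using derI[OF t] im(1)[OF t] by blast
  qed
  thus "0 \<le> Im D" by (simp flip: D)
  \<comment> \<open>The additional 1 in 1356 / 1000 is the integral of \<open>- ln t\<close> over
    (0, 1).\<close>
  have "norm (Re (G 1) - Re (G 0)) \<le> 1 * ((356 / 1000 - ln (norm w)) + 1 - ln 1)"
  proof (rule norm_diff_le_of_log_bound[OF zero_less_one contR])
    fix t :: real assume t: "0 < t" "t < 1"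
    show "((\<lambda>t. Re (G t)) has_vector_derivative - ln (norm (1 - exp (of_real t * w)))) (at t)"
      using derR[OF t] by (simp add: has_real_derivative_iff_has_vector_derivative)
    show "norm (- ln (norm (1 - exp (of_real t * w)))) \<le> 356 / 1000 - ln (norm w) - ln t"
      using re[OF t] by simp
  qed
  thus "Re D \<le> 1356 / 1000 - ln (norm w)" by (simp flip: D)
  have "pi / 2 * 0 - Im (G 0) \<le> pi / 2 * 1 - Im (G 1)"
  proof (rule DERIV_nonneg_imp_increasing_open[of 0 1 "\<lambda>t. pi / 2 * t - Im (G t)"])
    fix t :: real assume t: "0 < t" "t < 1"
    have "((\<lambda>t. pi / 2 * t - Im (G t)) has_real_derivative pi / 2 - - Im (Ln (1 - exp (of_real t * w)))) (at t)"
      by (intro DERIV_diff derI t) (auto intro!: derivative_eq_intros)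
    thus "\<exists>y. ((\<lambda>t. pi / 2 * t - Im (G t)) has_real_derivative y) (at t) \<and> 0 \<le> y"
      using im(2)[OF t] by (intro exI conjI) auto
  qed (auto intro!: continuous_intros contI)
  thus "Im D \<le> pi / 2" by (simp flip: D)
qed

text \<open>\<open>N\<close> is the squared modulus of 1 + Q - i P, the denominator of
  \<open>w = i x / (1 + Q - i P)\<close> in the case \<open>A = 0\<close>. The estimates bound in
  turn the squared relative distance from \<open>w\<close> to \<open>i x\<close>,
  \<open>Im w / x\<close> from below, and \<open>- Re w / x\<close>.\<close>

lemma quotient_bounds:
  fixes P Q :: real
  assumes P: "0 \<le> P" "P \<le> 6 / 10" and Q: "0 \<le> Q" "Q \<le> 1 / 4"
  defines "N \<equiv> (1 + Q) ^ 2 + P ^ 2"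
  shows "1 \<le> N" "Q ^ 2 + P ^ 2 \<le> 27 / 100 * N" "64 / 100 * N \<le> 1 + Q" "P \<le> 45 / 100 * N"
proof -
  have N: "N = 1 + 2 * Q + Q ^ 2 + P ^ 2" by (simp add: N_def power2_eq_square algebra_simps)
  have P2: "P ^ 2 \<le> 36 / 100" using power_mono[OF P(2,1), of 2] by (simp add: power2_eq_square)
  have Q2: "Q ^ 2 \<le> Q / 4" using mult_left_mono[OF Q(2,1)] by (simp add: power2_eq_square)
  have pos: "0 \<le> P ^ 2" "0 \<le> Q ^ 2" by auto
  show "1 \<le> N" using N Q pos by linarith
  show "Q ^ 2 + P ^ 2 \<le> 27 / 100 * N" using N Q P2 Q2 pos by linarith
  show "64 / 100 * N \<le> 1 + Q" using N Q P2 Q2 pos by linarith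
  \<comment> \<open>The product gives a lower bound for \<open>P ^ 2\<close> that is linear in
    \<open>P\<close>, strong enough to reach 45 / 100 at the end of the range.\<close>
  have "0 \<le> (6 / 10 - P) * (104 / 100 - P)" using P by (intro mult_nonneg_nonneg) auto
  also have "(6 / 10 - P) * (104 / 100 - P) = (624 / 1000) - (164 / 100) * P + P ^ 2"
    by (simp add: power2_eq_square field_simps)
  finally have "0 \<le> 624 / 1000 - (164 / 100) * P + P ^ 2" .
  thus "P \<le> 45 / 100 * N" using N P Q pos by linarith
qed

text \<open>Inserting \<open>dilog \<rho> = dilog 1 + w * D\<close> into the equation for
  \<open>w\<close> and solving gives \<open>w = i x / (1 + Q - i P)\<close>, where P + i Q is
  \<open>D / (2 pi b)\<close>. Both \<open>P\<close> and \<open>Q\<close> are nonnegative, so the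
  denominator has modulus at least 1. The last claim uses that \<open>norm w\<close> is O(1 / b) and
  \<open>norm D\<close> is O(1 + ln b).\<close>

lemma zero_A_eq_0:
  fixes B :: int and \<rho> :: complex
  assumes B: "0 < B" and zero: "phi 0 B \<rho> = 0" "0 < Im \<rho>"
  defines "x \<equiv> pi / (12 * real_of_int B)" and "w \<equiv> Ln \<rho>"
  shows "norm (w - \<i> * of_real x) ^ 2 \<le> 27 / 100 * x ^ 2"
    and "64 / 100 * x \<le> Im w" "Im w \<le> x" "Re w < 0" "- Re w \<le> 45 / 100 * x"
    and "norm (dilog \<rho> - dilog 1) \<le> 10 * (1 + ln B) / B"
proof -
  define b where "b = real_of_int B"
  have b: "1 \<le> b" using B by (simp add: b_def)
  have x: "0 < x" "x \<le> (2618 / 10000) / b" "x \<le> 2618 / 10000"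
  proof -
    show "0 < x" using B by (simp add: x_def)
    show 1: "x \<le> (2618 / 10000) / b"
      using b pi_bounds by (simp add: x_def b_def[symmetric] field_simps)
    have "(2618 / 10000) / b \<le> 2618 / 10000" using b by (simp add: field_simps)
    thus "x \<le> 2618 / 10000" using 1 by linarith
  qed
  have \<rho>0: "\<rho> \<noteq> 0" using zero by auto
  have \<rho>1: "norm \<rho> < 1" by (rule zero_upper(1)[OF B zero])
  have Rew: "Re w < 0" using \<rho>0 \<rho>1 by (simp add: w_def)
  thus "Re w < 0" .
  have Imw: "0 < Im w" using Im_Ln_pos_lt_imp[OF zero(2)] by (simp add: w_def)
  have weq: "w = \<i> * dilog \<rho> / of_real (2 * pi * b)"
    using Ln_zero_eq[OF zero(1) B] by (simp add: w_def b_def)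
  have "norm w = norm (dilog \<rho>) / (2 * pi * b)"
    unfolding weq using b by (simp add: norm_mult norm_divide)
  also have "\<dots> \<le> (pi ^ 2 / 6) / (2 * pi * b)"
    using norm_dilog_le[OF less_imp_le[OF \<rho>1]] b by (intro divide_right_mono) auto
  also have "\<dots> = x" by (simp add: x_def b_def power2_eq_square)
  finally have nw: "norm w \<le> x" .
  thus "Im w \<le> x" using abs_Im_le_cmod[of w] by linarith
  have w0: "w \<noteq> 0" using Rew by auto
  define D where "D = (dilog (exp w) - dilog 1) / w"
  have "norm w \<le> 262 / 1000" using nw x(3) by linarith
  note D = dilog_quotient[OF Rew Imw this, folded D_def]
  have exp_w: "exp w = \<rho>" using \<rho>0 by (simp add: w_def)
  define P Q where "P = Re D / (2 * pi * b)" and "Q = Im D / (2 * pi * b)"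
  define N where "N = (1 + Q) ^ 2 + P ^ 2"
  have pb: "0 < 2 * pi * b" using b by simp
  have P0: "0 \<le> P" and Q0: "0 \<le> Q" using D pb by (auto simp: P_def Q_def)
  have "Q \<le> (pi / 2) / (2 * pi * b)" unfolding Q_def using D pb by (intro divide_right_mono) auto
  also have "\<dots> \<le> 1 / 4" using b by (simp add: field_simps)
  finally have Q1: "Q \<le> 1 / 4" .
  have Dc: "D / of_real (2 * pi * b) = Complex P Q"
    by (simp add: P_def Q_def complex_eq_iff Re_divide_of_real Im_divide_of_real)
  have "dilog \<rho> = dilog 1 + w * D" using w0 by (simp add: D_def exp_w)
  hence "w = \<i> * (dilog 1 / of_real (2 * pi * b)) + w * (\<i> * (D / of_real (2 * pi * b)))"
    by (subst weq) (simp add: add_divide_distrib ring_distribs)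
  also have "dilog 1 / of_real (2 * pi * b) = of_real x"
    unfolding dilog_one of_real_divide[symmetric] x_def b_def by (simp add: power2_eq_square)
  finally have key: "w * Complex (1 + Q) (- P) = \<i> * of_real x"
    unfolding Dc by (simp add: complex_eq_iff algebra_simps)
  have nN: "norm (Complex (1 + Q) (- P)) ^ 2 = N"
    unfolding cmod_power2 N_def by simp
  have nwN: "norm w ^ 2 * N = x ^ 2"
    unfolding nN[symmetric] power_mult_distrib[symmetric] norm_mult[symmetric] key
    by (simp add: norm_mult)
  \<comment> \<open>The bound on \<open>Re D\<close> contains \<open>- ln (norm w)\<close>, and
    \<open>norm w\<close> is x divided by this modulus, so \<open>P\<close> is bounded only
    implicitly. The logarithm of the modulus is at most Q + P; this \<open>P\<close> is absorbed by
    the left-hand side \<open>2 * pi * b * P\<close> below.\<close>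
  have "norm (Complex (1 + Q) (- P)) \<le> \<bar>1 + Q\<bar> + \<bar>- P\<bar>"
    using cmod_le[of "Complex (1 + Q) (- P)"] by simp
  hence s: "norm (Complex (1 + Q) (- P)) \<le> 1 + Q + P" using P0 Q0 by simp
  have nz: "Complex (1 + Q) (- P) \<noteq> 0" using Q0 by (auto simp: complex_eq_iff)
  have "norm w * norm (Complex (1 + Q) (- P)) = x"
    unfolding norm_mult[symmetric] key using x by (simp add: norm_mult)
  hence "ln x = ln (norm w) + ln (norm (Complex (1 + Q) (- P)))"
    using ln_mult_pos[of "norm w" "norm (Complex (1 + Q) (- P))"] w0 nz by simp
  moreover have "ln (norm (Complex (1 + Q) (- P))) \<le> norm (Complex (1 + Q) (- P)) - 1"
    using nz by (intro ln_le_minus_one) simp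
  moreover have "- ln x = ln (12 * b / pi)"
    using b by (simp add: x_def b_def[symmetric] ln_div)
  ultimately have lnw: "- ln (norm w) \<le> ln (12 * b / pi) + 1 / 4 + P" using s Q1 by linarith
  have ReD: "Re D = 2 * pi * b * P" using b by (simp add: P_def)
  \<comment> \<open>The constant is 1356 / 1000 + 1 / 4, the latter bounding
    \<open>Q\<close>.\<close>
  have p1: "2 * pi * b * P \<le> 1606 / 1000 + ln (12 * b / pi) + P"
    using D(2) lnw unfolding ReD by linarith
  have pi12: "12 / pi \<le> 382 / 100" using pi_bounds by (simp add: field_simps)
  have "P \<le> 6 / 10"
  proof -
    have "ln (12 * b / pi) \<le> 2 / 5 * (12 * b / pi)" using b by (intro ln_le_two_fifths) simp
    also have "\<dots> = 2 / 5 * b * (12 / pi)" by simp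
    also have "\<dots> \<le> 2 / 5 * b * (382 / 100)" using pi12 b by (intro mult_left_mono) auto
    finally have "2 * pi * b * P \<le> 1606 / 1000 * b + 1528 / 1000 * b + P"
      using p1 b by linarith
    moreover have "P \<le> b * P" using mult_right_mono[OF b P0] by simp
    ultimately have "2 * pi * b * P \<le> 3134 / 1000 * b + b * P" by linarith
    hence "b * ((2 * pi - 1) * P) \<le> b * (3134 / 1000)" by (simp add: algebra_simps)
    hence *: "(2 * pi - 1) * P \<le> 3134 / 1000" using b by simp
    have "5283 / 1000 * P \<le> (2 * pi - 1) * P"
      using P0 pi_bounds by (intro mult_right_mono) auto
    thus ?thesis using * by linarith
  qed
  note q = quotient_bounds[OF P0 this Q0 Q1, folded N_def]
  have N0: "0 < N" using q(1) by linarith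
  have "w * Complex (1 + Q) (- P) * Complex (1 + Q) P = \<i> * of_real x * Complex (1 + Q) P"
    unfolding key ..
  moreover have "Complex (1 + Q) (- P) * Complex (1 + Q) P = of_real N"
    by (simp add: complex_eq_iff N_def power2_eq_square)
  ultimately have "w * of_real N = \<i> * of_real x * Complex (1 + Q) P"
    by (simp add: mult.assoc)
  hence "Re (w * of_real N) = Re (\<i> * of_real x * Complex (1 + Q) P)"
    "Im (w * of_real N) = Im (\<i> * of_real x * Complex (1 + Q) P)" by simp_all
  hence ReN: "Re w * N = - (x * P)" and ImN: "Im w * N = x * (1 + Q)" by simp_all
  have "64 / 100 * x * N \<le> Im w * N"
    unfolding ImN using mult_left_mono[OF q(3), of x] x by (simp add: mult_ac)
  thus "64 / 100 * x \<le> Im w" using N0 by simp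
  have "(- Re w) * N \<le> (45 / 100 * x) * N"
    using ReN mult_left_mono[OF q(4), of x] x by (simp add: mult_ac)
  thus "- Re w \<le> 45 / 100 * x" using N0 by (simp only: mult_le_cancel_right_pos)
  have wx: "w - \<i> * of_real x = - (w * Complex Q (- P))"
    unfolding key[symmetric] by (simp add: complex_eq_iff algebra_simps)
  have "norm (w - \<i> * of_real x) ^ 2 * N = (norm w ^ 2 * N) * (Q ^ 2 + P ^ 2)"
    unfolding wx norm_minus_cancel norm_mult power_mult_distrib
    by (simp add: cmod_power2)
  also have "\<dots> \<le> x ^ 2 * (27 / 100 * N)"
    unfolding nwN using q(2) by (intro mult_left_mono) auto
  finally have "norm (w - \<i> * of_real x) ^ 2 * N \<le> (27 / 100 * x ^ 2) * N" by (simp add: mult_ac)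
  thus "norm (w - \<i> * of_real x) ^ 2 \<le> 27 / 100 * x ^ 2"
    using N0 by (simp only: mult_le_cancel_right_pos)
  have "norm (dilog \<rho> - dilog 1) = norm w * norm D"
    using w0 by (simp add: D_def exp_w norm_divide)
  also have "norm D \<le> Re D + Im D" using cmod_le[of D] D by simp
  also have "Re D \<le> 2206 / 1000 + ln (12 / pi) + ln b"
  proof -
    have "ln (12 * b / pi) = ln (12 / pi * b)" by simp
    also have "\<dots> = ln (12 / pi) + ln b" using b by (intro ln_mult_pos) auto
    finally show ?thesis using p1 \<open>P \<le> (6 / 10)\<close> unfolding ReD by linarith
  qed
  also have "ln (12 / pi) \<le> 1528 / 1000"
  proof -
    have "ln (12 / pi) \<le> 2 / 5 * (12 / pi)" by (rule ln_le_two_fifths) simp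
    also have "\<dots> \<le> 2 / 5 * (382 / 100)" by (intro mult_left_mono pi12) simp
    finally show ?thesis by simp
  qed
  finally have "norm (dilog \<rho> - dilog 1) \<le> norm w * (2206 / 1000 + 1528 / 1000 + ln b + Im D)"
    by (simp add: mult_left_mono)
  also have "\<dots> \<le> ((2618 / 10000) / b) * (10 * (1 + ln b))"
  proof (intro mult_mono)
    show "norm w \<le> (2618 / 10000) / b" using nw x(2) by linarith
    have "0 \<le> ln b" using b by simp
    thus "2206 / 1000 + 1528 / 1000 + ln b + Im D \<le> 10 * (1 + ln b)"
      using D(4) pi_bounds by (simp add: field_simps)
    show "0 \<le> 2206 / 1000 + 1528 / 1000 + ln b + Im D"
      using \<open>0 \<le> ln b\<close> D(3) by (intro add_nonneg_nonneg) auto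
  qed (use b in auto)
  also have "\<dots> \<le> 10 * (1 + ln b) / b"
  proof -
    have "2618 / 10000 * (10 * (1 + ln b) / b) \<le> 1 * (10 * (1 + ln b) / b)"
      using b by (intro mult_right_mono) auto
    thus ?thesis by simp
  qed
  finally show "norm (dilog \<rho> - dilog 1) \<le> 10 * (1 + ln B) / B" by (simp add: b_def)
qed

text \<open>The distance to the singularity 1 is of the order of x, as is the initial error, so the
  heights decide. The zero has height at least \<open>553 / 1000 * x\<close>, the later iterates are
  within \<open>191 / 1000 * x\<close> of it, and the difference still exceeds the height
  \<open>36 / 100 * x\<close> at which the region is cut off.\<close>

lemma newton_A_eq_0:
  fixes B :: int and \<rho> :: complex
  assumes B: "0 < B" and zero: "phi 0 B \<rho> = 0" "0 < Im \<rho>"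
  shows "newton_seq 0 B n \<noteq> 0 \<and> newton_seq 0 B n \<noteq> 1 \<and> dphi 0 B (newton_seq 0 B n) \<noteq> 0"
    and "converges_quadratically (newton_seq 0 B) \<rho>"
proof -
  define b where "b = real_of_int B"
  define x where "x = pi / (12 * b)"
  define w where "w = Ln \<rho>"
  define S where "S = {z. (36 / 100) * x \<le> Im z} \<inter> {z. (8 / 10) \<le> Re z} \<inter> cball 0 (105 / 100)"
  have b: "1 \<le> b" using B by (simp add: b_def)
  have x0: "0 < x" using b by (simp add: x_def)
  have x1: "x \<le> 2618 / 10000"
  proof -
    have "x \<le> pi / (12 * 1)" unfolding x_def using b by (intro divide_left_mono mult_left_mono) auto
    thus ?thesis using pi_bounds by linarith
  qed
  note ax = zero_A_eq_0[OF B zero, folded b_def, folded x_def w_def]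
  have \<rho>0: "\<rho> \<noteq> 0" using zero by auto
  have exp_w: "exp w = \<rho>" using \<rho>0 by (simp add: w_def)
  have x2: "x ^ 2 \<le> 2618 / 10000 * x"
    unfolding power2_eq_square using x0 x1 by (intro mult_right_mono) auto
  have sin_ge: "98 / 100 * y \<le> sin y" if y: "0 \<le> y" "y \<le> x" for y
  proof -
    have "y ^ 2 \<le> (2618 / 10000) ^ 2" using y x1 by (intro power_mono) auto
    hence "y ^ 2 * y \<le> 12 / 100 * y"
      using y by (intro mult_right_mono) (auto simp: power2_eq_square)
    thus ?thesis using sin_ge_cubic[OF y(1)] by (simp add: power2_eq_square power3_eq_cube)
  qed
  have cos_ge: "965 / 1000 \<le> cos y" if y: "0 \<le> y" "y \<le> x" for y
  proof -
    have "sin (y / 2) ^ 2 \<le> (y / 2) ^ 2"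
      using abs_sin_x_le_abs_x[of "y / 2"] by (simp only: abs_le_square_iff)
    moreover have "(y / 2) ^ 2 \<le> (1309 / 10000) ^ 2" using y x1 by (intro power_mono) auto
    hence "(y / 2) ^ 2 \<le> 172 / 10000" by (simp add: power2_eq_square)
    moreover have "cos y = 1 - 2 * sin (y / 2) ^ 2" using cos_double_sin[of "y / 2"] by simp
    ultimately show ?thesis by linarith
  qed
  have Imw: "0 \<le> Im w" using ax(2) x0 by linarith
  have e_Re: "882 / 1000 \<le> exp (Re w)"
  proof -
    have "- Re w \<le> 45 / 100 * (2618 / 10000)"
      using ax(5) x1 mult_left_mono[OF x1, of "45 / 100"] by linarith
    thus ?thesis using exp_ge_add_one_self[of "Re w"] by linarith
  qed
  have Im\<rho>: "553 / 1000 * x \<le> Im \<rho>"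
  proof -
    have "98 / 100 * (64 / 100 * x) \<le> 98 / 100 * Im w" using ax(2) by (intro mult_left_mono) auto
    also have "\<dots> \<le> sin (Im w)" by (rule sin_ge[OF Imw ax(3)])
    finally have "882 / 1000 * (98 / 100 * (64 / 100 * x)) \<le> exp (Re w) * sin (Im w)"
      using e_Re x0 by (intro mult_mono) auto
    hence "882 / 1000 * (98 / 100 * (64 / 100 * x)) \<le> Im \<rho>"
      unfolding exp_w[symmetric] Im_exp .
    thus ?thesis using x0 by simp
  qed
  have Re\<rho>: "851 / 1000 \<le> Re \<rho>"
  proof -
    have "882 / 1000 * (965 / 1000) \<le> exp (Re w) * cos (Im w)"
      using e_Re cos_ge[OF Imw ax(3)] by (intro mult_mono) auto
    thus ?thesis unfolding exp_w[symmetric] Re_exp by simp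
  qed
  have n\<rho>: "norm \<rho> \<le> 1" using zero_upper(1)[OF B zero] by simp
  define c where "c = exp (\<i> * of_real x)"
  have c: "newton_seq 0 B 0 = c"
    by (simp add: c_def x_def b_def mult_ac)
  have c_cis: "c = cis x" by (simp add: c_def cis_conv_exp)
  have e: "norm (c - \<rho>) ^ 2 \<le> 27 / 100 * x ^ 2"
  proof -
    have "norm (\<rho> - c) \<le> norm (w - \<i> * of_real x)"
      unfolding exp_w[symmetric] c_def using ax(4) by (intro norm_exp_diff_le) auto
    hence "norm (\<rho> - c) ^ 2 \<le> norm (w - \<i> * of_real x) ^ 2" by (intro power_mono) auto
    thus ?thesis using ax(1) unfolding norm_minus_commute[of c] by linarith
  qed
  have e1: "27 / 10 * norm (c - \<rho>) < 1"
  proof -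
    have "norm (c - \<rho>) ^ 2 \<le> 27 / 100 * (2618 / 10000 * (2618 / 10000))"
      using e x2 mult_left_mono[OF x1, of "2618 / 10000"] by linarith
    also have "\<dots> \<le> (14 / 100) ^ 2" by (simp add: power2_eq_square)
    finally have "norm (c - \<rho>) \<le> 14 / 100" by (rule power2_le_imp_le) simp
    thus ?thesis by linarith
  qed
  have e2: "27 / 10 * norm (c - \<rho>) ^ 2 \<le> 191 / 1000 * x" "27 / 10 * norm (c - \<rho>) ^ 2 \<le> 5 / 100"
    using e x2 x1 x0 by linarith+
  have S: "Im z \<ge> (36 / 100) * x" "Re z \<ge> (8 / 10)" "norm z \<le> 105 / 100" if "z \<in> S" for z
    using that unfolding S_def by simp_all
  have Impos: "0 < Im z" if "z \<in> S" for z
    using S(1)[OF that] x0 by linarith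
  have \<rho>S: "\<rho> \<in> S" using Im\<rho> Re\<rho> n\<rho> x0 by (simp add: S_def)
  have cS: "c \<in> S" using sin_ge[of x] cos_ge[of x] x0 by (simp add: S_def c_cis)
  have ball: "cball \<rho> (27 / 10 * norm (c - \<rho>) ^ 2) \<subseteq> S"
  proof
    fix z assume "z \<in> cball \<rho> (27 / 10 * norm (c - \<rho>) ^ 2)"
    hence z: "norm (z - \<rho>) \<le> 191 / 1000 * x" "norm (z - \<rho>) \<le> 5 / 100"
      using e2 by (auto simp: dist_norm norm_minus_commute)
    have "36 / 100 * x \<le> Im z" using z(1) abs_Im_le_cmod[of "z - \<rho>"] Im\<rho> x0 by simp
    moreover have "8 / 10 \<le> Re z" using z(2) abs_Re_le_cmod[of "z - \<rho>"] Re\<rho> by simp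
    moreover have "norm z \<le> 105 / 100"
      using z(2) n\<rho> norm_triangle_ineq[of "z - \<rho>" \<rho>] by simp
    ultimately show "z \<in> S" by (simp add: S_def)
  qed
  have slit: "z \<notin> complex_of_real ` {1..}" if "z \<in> S" for z
    using Impos[OF that] by (intro not_in_slit) simp
  have d0: "0 < (36 / 100) * x" using x0 by simp
  have d: "36 / 100 * x \<le> norm (1 - z)" if "z \<in> S" for z
    using S(1)[OF that] abs_Im_le_cmod[of "1 - z"] by simp
  have r: "8 / 10 \<le> norm z" if "z \<in> S" for z
    using S(2)[OF that] complex_Re_le_cmod[of z] by linarith
  have xinv: "1 / (36 / 100 * x) \<le> 1062 / 100 * b"
  proof -
    have "1 / (36 / 100 * x) = (1200 / (36 * pi)) * b" using b by (simp add: x_def field_simps)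
    also have "\<dots> \<le> 1062 / 100 * b"
      using b pi_bounds by (intro mult_right_mono) (auto simp: field_simps)
    finally show ?thesis .
  qed
  \<comment> \<open>The logarithm of the distance to 1 is of order ln b; replacing it by a multiple
    of \<open>b\<close> lets \<open>b\<close> cancel in the Newton constant.\<close>
  have L: "norm (Ln (1 - z)) \<le> pi * b + 27 / 10 * b" if z: "z \<in> S" for z
  proof -
    have nz: "1 - z \<noteq> 0" using d[OF z] d0 by auto
    have "norm (1 - z) ^ 2 = 1 - 2 * Re z + norm z ^ 2"
      unfolding cmod_power2 by (simp add: power2_eq_square algebra_simps)
    also have "norm z ^ 2 \<le> (105 / 100) ^ 2" using S(3)[OF z] by (intro power_mono) auto
    finally have "norm (1 - z) ^ 2 \<le> 1 ^ 2" using S(2)[OF z] by (simp add: power2_eq_square)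
    hence "norm (1 - z) \<le> 1" by (rule power2_le_imp_le) simp
    moreover have "- ln (36 / 100 * x) = ln (1 / (36 / 100 * x))"
      using x0 by (simp add: ln_div)
    moreover have "ln (1 / (36 / 100 * x)) \<le> 4 / 25 * (1 / (36 / 100 * x)) + 1"
      using x0 by (intro ln_le_affine) simp
    moreover have "4 / 25 * (1 / (36 / 100 * x)) \<le> 4 / 25 * (1062 / 100 * b)"
      by (intro mult_left_mono xinv) simp
    ultimately have "\<bar>ln (norm (1 - z))\<bar> \<le> 27 / 10 * b"
      using b by (intro abs_ln_le[OF d0 d[OF z]]) auto
    moreover have "pi * 1 \<le> pi * b" using b by (intro mult_left_mono) auto
    ultimately show ?thesis using norm_Ln_le[OF nz] abs_Im_Ln_le_pi[OF nz] by linarith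
  qed
  have m: "2 * pi * B \<le> norm (- Ln (1 - z) + 2 * of_real pi * \<i> * of_int B)" if "z \<in> S" for z
    using Impos[OF that] slit[OF that] by (intro norm_dphi_numerator_ge(1)) auto
  have mpos: "0 < 2 * pi * B" using B by simp
  have K: "(105 / 100) / (2 * (2 * pi * B)) * ((1 / (36 / 100 * x) + (2 * pi * B + (pi * b + 27 / 10 * b)) / (8 / 10)) / (8 / 10)) \<le> 27 / 10"
  proof -
    have "(105 / 100) / (2 * (2 * pi * b)) * ((1 / (36 / 100 * x) + (2 * pi * b + (pi * b + 27 / 10 * b)) / (8 / 10)) / (8 / 10))
        \<le> (105 / 100) / (2 * (2 * pi * b)) * ((1062 / 100 * b + (2 * pi * b + (pi * b + 27 / 10 * b)) / (8 / 10)) / (8 / 10))"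
      using b xinv by (intro mult_left_mono divide_right_mono add_right_mono) auto
    also have "\<dots> \<le> 27 / 10" using b pi_bounds by (simp add: field_simps)
    finally show ?thesis by (simp add: b_def)
  qed
  have cvx: "convex S"
    unfolding S_def by (intro convex_Int convex_cball convex_halfspace_Im_ge convex_halfspace_Re_ge)
  have side: "S \<subseteq> {z. 0 \<le> Im z} \<or> S \<subseteq> {z. Im z < 0}" using Impos by force
  note main = newton_seq_converges[OF B cvx side slit d0 d _ r S(3) L mpos m K \<rho>S zero(1), unfolded c, OF _ _ _ _ _ _ _ cS e1 ball]
  show "newton_seq 0 B n \<noteq> 0 \<and> newton_seq 0 B n \<noteq> 1 \<and> dphi 0 B (newton_seq 0 B n) \<noteq> 0"
    by (rule main(1)) auto
  show "converges_quadratically (newton_seq 0 B) \<rho>"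
    by (rule main(2)) auto
qed

subsection \<open>The approximation\<close>

text \<open>With the exact exponent \<open>u\<close> and its approximation \<open>v\<close>,
  obtained by replacing \<open>dilog \<rho>\<close> with the value on the circle, the error is
  \<open>cis \<theta>\<close> times (exp u - 1 - u) + (u - v). The first term is O(1 / b^2), the
  second O((1 + ln b) / b^2).\<close>

lemma approx_error:
  fixes A B :: int
  assumes A: "2 * \<bar>A\<bar> \<le> B" and B: "0 < B" and zero: "phi A B \<rho> = 0" "\<rho> \<noteq> 0"
    and dil: "norm (dilog \<rho>) \<le> 3"
    and diff: "norm (dilog \<rho> - dilog (cis (2 * pi * A / B))) \<le> 10 * (1 + ln B) / B"
  shows "norm (\<rho> - zero_approx A B) \<le> 10 * ((1 + ln B) / real_of_int B ^ 2)"
proof -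
  define b where "b = real_of_int B"
  define \<theta> where "\<theta> = 2 * pi * A / B"
  define u where "u = Ln \<rho> - \<i> * of_real \<theta>"
  define v where "v = \<i> * dilog (cis \<theta>) / of_real (2 * pi * b)"
  have b: "1 \<le> b" using B by (simp add: b_def)
  have lnb: "0 \<le> ln b" using b by simp
  have "2 * \<bar>real_of_int A\<bar> \<le> b" unfolding b_def using A by linarith
  hence "pi * (2 * \<bar>real_of_int A\<bar>) \<le> pi * b" by (intro mult_left_mono) auto
  hence \<theta>: "\<bar>\<theta>\<bar> \<le> pi"
    unfolding \<theta>_def abs_divide abs_mult using b by (simp add: b_def field_simps)
  have "\<bar>\<theta>\<bar> / (2 * pi) = of_int \<bar>A\<bar> / B"
    unfolding \<theta>_def abs_divide abs_mult using B by simp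
  hence approx: "zero_approx A B = cis \<theta> * (1 + v)"
    unfolding zero_approx_def v_def dilog_cis[OF \<theta>]
    by (simp add: cis_conv_exp \<theta>_def b_def algebra_simps)
  have u: "u = \<i> * dilog \<rho> / of_real (2 * pi * b)"
    using Ln_zero_eq[OF zero(1) B] by (simp add: u_def \<theta>_def b_def)
  have "norm u = norm (dilog \<rho>) / (2 * pi * b)"
    unfolding u using b by (simp add: norm_mult norm_divide)
  also have "\<dots> \<le> 3 / (2 * 3 * b)" using dil b pi_bounds by (intro frac_le mult_right_mono) auto
  finally have nu: "norm u \<le> 1 / (2 * b)" by simp
  \<comment> \<open>The real part of \<open>u\<close> is positive when the zero is outside the disc,
    so a Taylor bound valid on both sides is used.\<close>
  have "norm (exp u - (\<Sum>k\<le>1. u ^ k / fact k)) \<le> exp \<bar>Re u\<bar> * norm u ^ Suc 1 / fact 1"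
    by (rule Taylor_exp)
  hence "norm (exp u - 1 - u) \<le> exp \<bar>Re u\<bar> * norm u ^ 2"
    by (simp add: numeral_2_eq_2 algebra_simps)
  also have "\<dots> \<le> 4 * (1 / (2 * b)) ^ 2"
  proof (intro mult_mono power_mono nu)
    have "1 / (2 * b) \<le> 1" using b by simp
    hence "\<bar>Re u\<bar> \<le> 1" using nu abs_Re_le_cmod[of u] by linarith
    hence "exp \<bar>Re u\<bar> \<le> exp 1" by (simp only: exp_le_cancel_iff)
    thus "exp \<bar>Re u\<bar> \<le> 4" using e_less_272 by linarith
  qed auto
  finally have t1: "norm (exp u - 1 - u) \<le> 1 / b ^ 2" by (simp add: power2_eq_square)
  have "u - v = \<i> * (dilog \<rho> - dilog (cis \<theta>)) / of_real (2 * pi * b)"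
    unfolding u v_def by (simp add: diff_divide_distrib algebra_simps)
  hence "norm (u - v) = norm (dilog \<rho> - dilog (cis \<theta>)) / (2 * pi * b)"
    using b by (simp add: norm_mult norm_divide)
  also have "\<dots> \<le> (10 * (1 + ln b) / b) / (2 * 3 * b)"
    using diff b pi_bounds lnb by (intro frac_le mult_right_mono) (auto simp: \<theta>_def b_def)
  finally have bound: "norm (u - v) \<le> (10 * (1 + ln b) / b) / (2 * 3 * b)" .
  have t2: "norm (u - v) \<le> 2 * ((1 + ln b) / b ^ 2)"
  proof -
    have "(10 * (1 + ln b) / b) / (2 * 3 * b) = 5 / 3 * ((1 + ln b) / b ^ 2)"
      using b by (simp add: power2_eq_square field_simps)
    also have "\<dots> \<le> 2 * ((1 + ln b) / b ^ 2)" using lnb by (intro mult_right_mono) auto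
    finally have "(10 * (1 + ln b) / b) / (2 * 3 * b) \<le> 2 * ((1 + ln b) / b ^ 2)" .
    thus ?thesis using bound by linarith
  qed
  have "\<rho> - zero_approx A B = (\<rho> - cis \<theta>) - cis \<theta> * v"
    unfolding approx by (simp add: algebra_simps)
  also have "\<dots> = cis \<theta> * ((exp u - 1 - u) + (u - v))"
    unfolding diff_cis_eq[OF zero(2)] u_def[symmetric] by (simp add: algebra_simps)
  finally have "norm (\<rho> - zero_approx A B) = norm ((exp u - 1 - u) + (u - v))"
    by (simp add: norm_mult)
  also have "\<dots> \<le> 1 / b ^ 2 + 2 * ((1 + ln b) / b ^ 2)"
    using norm_triangle_ineq[of "exp u - 1 - u" "u - v"] t1 t2 by linarith
  also have "\<dots> \<le> 10 * ((1 + ln b) / b ^ 2)"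
  proof -
    have "1 / b ^ 2 \<le> (1 + ln b) / b ^ 2" using lnb by (intro divide_right_mono) auto
    moreover have "0 \<le> (1 + ln b) / b ^ 2" using lnb by simp
    ultimately show ?thesis by linarith
  qed
  finally show ?thesis by (simp add: b_def)
qed

text \<open>The sign of \<open>Im \<rho>\<close> fixes the sign of \<open>A\<close> and so the
  applicable case. In the lower half-plane \<open>A < 0\<close> and the strict inequality
  \<open>- B < 2 * A\<close> give B at least 3 and keep the initial value away from -1.\<close>

lemma newton_zero:
  fixes A B :: int
  assumes "- real_of_int B / 2 < real_of_int A" "real_of_int A \<le> real_of_int B / 2"
    and zero: "\<rho> \<noteq> 0" "phi A B \<rho> = 0"
  shows "newton_seq A B n \<noteq> 0 \<and> newton_seq A B n \<noteq> 1 \<and> dphi A B (newton_seq A B n) \<noteq> 0"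
    and "converges_quadratically (newton_seq A B) \<rho>"
    and "norm (\<rho> - zero_approx A B) \<le> 10 * ((1 + ln B) / real_of_int B ^ 2)"
proof -
  have AB: "- B < 2 * A" "2 * A \<le> B" using assms(1,2) by linarith+
  hence B: "0 < B" and A2: "2 * \<bar>A\<bar> \<le> B" by linarith+
  have "(\<forall>n. newton_seq A B n \<noteq> 0 \<and> newton_seq A B n \<noteq> 1 \<and> dphi A B (newton_seq A B n) \<noteq> 0) \<and>
    converges_quadratically (newton_seq A B) \<rho> \<and> norm (dilog \<rho>) \<le> 3 \<and>
    norm (dilog \<rho> - dilog (cis (2 * pi * A / B))) \<le> 10 * (1 + ln B) / B"
  proof (cases "0 < Im \<rho>")
    case True
    have "0 \<le> A" and dil: "norm (dilog \<rho>) \<le> 3"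
      using zero_upper[OF B zero(2) True] upper_dilog_bound by auto
    then consider "A = 0" | "0 < A" "B = 2 * A" | "0 < A" "2 * A < B" using AB by linarith
    thus ?thesis
    proof cases
      case 1
      have "phi 0 B \<rho> = 0" using zero(2) 1 by simp
      thus ?thesis
        using newton_A_eq_0[OF B _ True] zero_A_eq_0(6)[OF B _ True] dil 1 by simp
    next
      case 2
      thus ?thesis using zero_near_minus_one[OF 2 zero(2) True] dil by blast
    next
      case 3
      hence "3 \<le> B" "A \<noteq> 0" "2 * \<bar>A\<bar> < B" by linarith+
      from off_axis_zero[OF this zero(2,1) dil] dil show ?thesis by blast
    qed
  next
    case False
    hence Im: "Im \<rho> < 0" using zero_not_real[OF B zero(2,1)] by linarith
    have "A < 0" by (rule zero_lower(3)[OF B zero(2) Im])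
    hence A: "3 \<le> B" "A \<noteq> 0" "2 * \<bar>A\<bar> < B" using AB by linarith+
    have dil: "norm (dilog \<rho>) \<le> 3" by (rule lower_dilog_bound[OF A(1) zero(2) Im])
    from off_axis_zero[OF A zero(2,1) dil] dil show ?thesis by blast
  qed
  thus "newton_seq A B n \<noteq> 0 \<and> newton_seq A B n \<noteq> 1 \<and> dphi A B (newton_seq A B n) \<noteq> 0"
    "converges_quadratically (newton_seq A B) \<rho>"
    "norm (\<rho> - zero_approx A B) \<le> 10 * ((1 + ln B) / real_of_int B ^ 2)"
    using approx_error[OF A2 B zero(2,1)] by blast+
qed

text \<open>Division and \<open>Ln\<close> are total functions: \<open>\<rho> \<noteq> 0\<close>
  rules out the default value of \<open>Ln\<close> at 0, and the nonvanishing clause certifies that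
  no Newton step divides by zero or leaves the range where \<open>phi\<close> and
  \<open>dphi\<close> are meaningful.\<close>

theorem theorem1p3:
  shows "\<exists>C::real. \<forall>(A::int) (B::int) (\<rho>::complex).
    - real_of_int B / 2 < real_of_int A \<and> real_of_int A \<le> real_of_int B / 2 \<and>
    \<rho> \<noteq> 0 \<and> phi A B \<rho> = 0 \<longrightarrow>
      (\<forall>n. newton_seq A B n \<noteq> 0 \<and> newton_seq A B n \<noteq> 1 \<and> dphi A B (newton_seq A B n) \<noteq> 0) \<and>
      converges_quadratically (newton_seq A B) \<rho> \<and>
      norm (\<rho> - zero_approx A B) \<le> C * ((1 + ln (real_of_int B)) / (real_of_int B) ^ 2)"
proof (intro exI[of _ 10] allI impI, elim conjE)
  fix A B :: int and \<rho> :: complex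
  assume "- real_of_int B / 2 < real_of_int A" "real_of_int A \<le> real_of_int B / 2"
    "\<rho> \<noteq> 0" "phi A B \<rho> = 0"
  note newton_zero[OF this]
  thus "(\<forall>n. newton_seq A B n \<noteq> 0 \<and> newton_seq A B n \<noteq> 1 \<and> dphi A B (newton_seq A B n) \<noteq> 0) \<and>
      converges_quadratically (newton_seq A B) \<rho> \<and>
      norm (\<rho> - zero_approx A B) \<le> 10 * ((1 + ln (real_of_int B)) / (real_of_int B) ^ 2)"
    by blast
qed

end
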